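(* Let $\Gamma$ be a nontrivial additive subgroup of $\mathbb{R}$ and let $N$ be a lattice (finitely generated free abelian group). Let $\Sigma$ be a $\Gamma$-admissible fan in $N_{\mathbb{R}}\times\mathbb{R}_{\geq0}$. Then for some positive integer $k$ there are a rational fan $\widetilde{\Sigma}$ in $N_{\mathbb{R}}\times\mathbb{R}^k$ and a linear map $\iota\colon\mathbb{R}_{\geq0}\to\mathbb{R}^k$ which sends $1$ to a nonzero point of $\Gamma^k$ such that $\Sigma$ is the pullback $(\operatorname{id}_{N_{\mathbb{R}}}\times\iota)^*(\widetilde{\Sigma})$ of $\widetilde{\Sigma}$ along $\operatorname{id}_{N_{\mathbb{R}}}\times\iota\colon N_{\mathbb{R}}\times\mathbb{R}_{\ge0}\to N_{\mathbb{R}}\times\mathbb{R}^k$. Moreover, if $\Gamma$ is finitely generated as an abelian group, or, more generally, if the divisible hull $\mathbb{Q}\Gamma$ of $\Gamma$ is finite-dimensional as a $\mathbb{Q}$-vector space, then $k$ and $\iota$ can be chosen independently of $\Sigma$.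
   Context: Let $M=\operatorname{Hom}(N,\mathbb{Z})$, $N_{\mathbb{R}}=N\otimes_{\mathbb{Z}}\mathbb{R}$, and let $\langle\cdot,\cdot\rangle$ be the natural pairing. $\mathbb{Q}\Gamma\subset\mathbb{R}$ is the $\mathbb{Q}$-span of $\Gamma$. A polyhedral complex is a finite collection of polyhedra, closed under taking faces, such that any two members intersect either in the empty set or in a common face of both. A fan is a nonempty polyhedral complex consisting of strongly convex cones (cones containing no line). A fan in $N_{\mathbb{R}}\times\mathbb{R}_{\ge0}$ is a fan in $N_{\mathbb{R}}\times\mathbb{R}$ all of whose cones lie in $N_{\mathbb{R}}\times\mathbb{R}_{\geq0}$. A cone $\sigma\subset N_{\mathbb{R}}\times\mathbb{R}_{\ge0}$ is $\Gamma$-admissible if it is strongly convex and can be written as $\sigma=\{(w,t)\in N_{\mathbb{R}}\times\mathbb{R}_{\geq0}\mid \langle u_i,w\rangle+\gamma_i t\geq0\text{ for }i=1,\ldots,\ell\}$ with $u_i\in M$, $\gamma_i\in\Gamma$. A fan is $\Gamma$-admissible if all its cones are. A cone in $N_{\mathbb{R}}\times\mathbb{R}^k$ is rational if it is the set of $(w,\xi)$ satisfying finitely many inequalities $\langle u,w\rangle+f\cdot\xi\ge0$ with $u\in M$, $f\in\mathbb{Z}^k$; a fan is rational if all its cones are. A linear map $\mathbb{R}_{\ge0}\to\mathbb{R}^k$ (or $N_{\mathbb{R}}\times\mathbb{R}_{\ge0}\to W$) is the restriction of a linear map $\mathbb{R}\to\mathbb{R}^k$ (or $N_{\mathbb{R}}\times\mathbb{R}\to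 W$). For an injective linear map $\varphi\colon N_{\mathbb{R}}\times\mathbb{R}_{\geq0}\to W$ and a fan $\Sigma'$ in the real vector space $W$, the pullback of $\Sigma'$ along $\varphi$ is the fan $$\varphi^*(\Sigma')=\{\varphi^{-1}(\sigma),\ (\varphi|_{N_{\mathbb{R}}\times\{0\}})^{-1}(\sigma)\mid\sigma\in\Sigma'\}.$$ *)

theory Defs
  imports "HOL-Analysis.Analysis" "HOL-Analysis.Finite_Function_Topology"
begin

section \<open>Subgroups, lattices and duals\<close>

definition add_subgroup :: "'a::ab_group_add set \<Rightarrow> bool" where
  "add_subgroup G \<longleftrightarrow> 0 \<in> G \<and> (\<forall>x\<in>G. \<forall>y\<in>G. x + y \<in> G) \<and> (\<forall>x\<in>G. - x \<in> G)"

definition fg_subgroup :: "'a::ab_group_add set \<Rightarrow> bool" where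
  "fg_subgroup G \<longleftrightarrow> (\<exists>S. finite S \<and> G = add_subgroup hull S)"

text \<open>
  A lattice \<open>N\<close> is presented inside \<open>N\<otimes>\<real>\<close>: the type \<open>'v\<close> plays the role of \<open>N\<otimes>\<real>\<close>,
  and \<open>N\<close> is the subgroup generated by some finite \<open>\<real>\<close>-basis of it. The class
  \<open>real_vector\<close> is used rather than \<open>euclidean_space\<close> because the latter excludes rank 0.
\<close>

definition full_lattice :: "'v::real_vector set \<Rightarrow> bool" where
  "full_lattice N \<longleftrightarrow>
     (\<exists>B. finite B \<and> independent B \<and> span B = UNIV \<and> N = add_subgroup hull B)"

text \<open>
  The elements of \<open>M = Hom(N,\<int>)\<close>, each identified with its unique \<open>\<real>\<close>-linear extension to
  \<open>N\<otimes>\<real>\<close>; the pairing of \<open>u\<close> and \<open>w\<close> is then \<open>u w\<close>.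
\<close>

definition dual_lattice :: "'v::real_vector set \<Rightarrow> ('v \<Rightarrow> real) set" where
  "dual_lattice N = {u. linear u \<and> (\<forall>x\<in>N. u x \<in> \<int>)}"

interpretation rat_real: vector_space "\<lambda>(q::rat) (x::real). of_rat q * x"
  by unfold_locales (simp_all add: algebra_simps of_rat_add of_rat_mult)

definition fin_dim_divisible_hull :: "real set \<Rightarrow> bool" where
  "fin_dim_divisible_hull \<Gamma> \<longleftrightarrow> (\<exists>B. finite B \<and> rat_real.span B = rat_real.span \<Gamma>)"

section \<open>Polyhedral complexes and fans\<close>

text \<open>
  The number \<open>k\<close> is existentially quantified in the theorem, so \<open>\<real>\<^sup>k\<close> cannot be a
  type of its own. It is realised as the subspace of vectors supported on \<open>{..<k}\<close> of the
  real vector space \<open>nat \<Rightarrow>\<^sub>0 real\<close> of finitely supported sequences. Polyhedra are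
  therefore defined relative to a linear subspace \<open>W\<close> containing them.
\<close>

definition Rpow :: "nat \<Rightarrow> (nat \<Rightarrow>\<^sub>0 real) set" where
  "Rpow k = {\<xi>. Poly_Mapping.keys \<xi> \<subseteq> {..<k}}"

text \<open>
  Linear functionals on \<open>W\<close> are written as restrictions of linear functionals on the
  whole type, which is no loss since every functional on a subspace extends.
\<close>

definition polyhedron_in :: "'a::real_vector set \<Rightarrow> 'a set \<Rightarrow> bool" where
  "polyhedron_in W P \<longleftrightarrow>
     (\<exists>H :: (('a \<Rightarrow> real) \<times> real) set. finite H \<and> (\<forall>(f, b)\<in>H. linear f) \<and>
        P = {x\<in>W. \<forall>(f, b)\<in>H. b \<le> f x})"

text \<open>
  The library's \<open>face_of\<close> counts the empty set as a face. Here faces are nonempty, since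
  a fan contains only cones.
\<close>

definition polyhedral_complex :: "'a::real_vector set \<Rightarrow> 'a set set \<Rightarrow> bool" where
  "polyhedral_complex W \<Sigma> \<longleftrightarrow>
     finite \<Sigma> \<and>
     (\<forall>P\<in>\<Sigma>. polyhedron_in W P) \<and>
     (\<forall>P\<in>\<Sigma>. \<forall>F. F face_of P \<and> F \<noteq> {} \<longrightarrow> F \<in> \<Sigma>) \<and>
     (\<forall>P\<in>\<Sigma>. \<forall>Q\<in>\<Sigma>. P \<inter> Q = {} \<or> ((P \<inter> Q) face_of P \<and> (P \<inter> Q) face_of Q))"

definition contains_line :: "'a::real_vector set \<Rightarrow> bool" where
  "contains_line S \<longleftrightarrow> (\<exists>a d. d \<noteq> 0 \<and> (\<forall>t. a + t *\<^sub>R d \<in> S))"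

definition strongly_convex_cone :: "'a::real_vector set \<Rightarrow> bool" where
  "strongly_convex_cone \<sigma> \<longleftrightarrow> convex_cone \<sigma> \<and> \<not> contains_line \<sigma>"

definition fan_in :: "'a::real_vector set \<Rightarrow> 'a set set \<Rightarrow> bool" where
  "fan_in W \<Sigma> \<longleftrightarrow>
     \<Sigma> \<noteq> {} \<and> polyhedral_complex W \<Sigma> \<and> (\<forall>\<sigma>\<in>\<Sigma>. strongly_convex_cone \<sigma>)"

section \<open>Admissible fans, rational fans and pullbacks\<close>

definition admissible_cone :: "'v::real_vector set \<Rightarrow> real set \<Rightarrow> ('v \<times> real) set \<Rightarrow> bool" where
  "admissible_cone N \<Gamma> \<sigma> \<longleftrightarrow>
     strongly_convex_cone \<sigma> \<and>
     (\<exists>H. finite H \<and> H \<subseteq> dual_lattice N \<times> \<Gamma> \<and>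
        \<sigma> = {(w, t). 0 \<le> t \<and> (\<forall>(u, \<gamma>)\<in>H. 0 \<le> u w + \<gamma> * t)})"

definition admissible_fan :: "'v::real_vector set \<Rightarrow> real set \<Rightarrow> ('v \<times> real) set set \<Rightarrow> bool" where
  "admissible_fan N \<Gamma> \<Sigma> \<longleftrightarrow>
     fan_in UNIV \<Sigma> \<and> (\<forall>\<sigma>\<in>\<Sigma>. \<sigma> \<subseteq> UNIV \<times> {0..}) \<and> (\<forall>\<sigma>\<in>\<Sigma>. admissible_cone N \<Gamma> \<sigma>)"

definition rational_cone ::
    "'v::real_vector set \<Rightarrow> nat \<Rightarrow> ('v \<times> (nat \<Rightarrow>\<^sub>0 real)) set \<Rightarrow> bool" where
  "rational_cone N k \<sigma> \<longleftrightarrow>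
     (\<exists>H :: (('v \<Rightarrow> real) \<times> (nat \<Rightarrow> int)) set.
        finite H \<and> (\<forall>(u, f)\<in>H. u \<in> dual_lattice N) \<and>
        \<sigma> = {(w, \<xi>). \<xi> \<in> Rpow k \<and>
              (\<forall>(u, f)\<in>H. 0 \<le> u w + (\<Sum>i<k. of_int (f i) * Poly_Mapping.lookup \<xi> i))})"

definition rational_fan ::
    "'v::real_vector set \<Rightarrow> nat \<Rightarrow> ('v \<times> (nat \<Rightarrow>\<^sub>0 real)) set set \<Rightarrow> bool" where
  "rational_fan N k \<Sigma> \<longleftrightarrow>
     fan_in (UNIV \<times> Rpow k) \<Sigma> \<and> (\<forall>\<sigma>\<in>\<Sigma>. rational_cone N k \<sigma>)"

text \<open>
  A linear map on the half-space \<open>N\<otimes>\<real> \<times> \<real>\<^bsub>\<ge>0\<^esub>\<close> is represented by its unique linear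
  extension \<open>\<phi>\<close> to \<open>N\<otimes>\<real> \<times> \<real>\<close>; preimages are taken in the half-space.
\<close>

definition fan_pullback :: "('v \<times> real \<Rightarrow> 'w) \<Rightarrow> 'w set set \<Rightarrow> ('v \<times> real) set set" where
  "fan_pullback \<phi> \<Sigma> =
     (\<lambda>\<sigma>. \<phi> -` \<sigma> \<inter> UNIV \<times> {0..}) ` \<Sigma> \<union> (\<lambda>\<sigma>. \<phi> -` \<sigma> \<inter> UNIV \<times> {0}) ` \<Sigma>"

text \<open>
  The map \<open>\<iota>\<close> from \<open>\<real>\<^bsub>\<ge>0\<^esub>\<close> to \<open>\<real>\<^sup>k\<close>, again through its linear extension to \<open>\<real>\<close>,
  sending 1 to a nonzero point of \<open>\<Gamma>\<^sup>k\<close>.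
\<close>

definition ray_map :: "real set \<Rightarrow> nat \<Rightarrow> (real \<Rightarrow> (nat \<Rightarrow>\<^sub>0 real)) \<Rightarrow> bool" where
  "ray_map \<Gamma> k \<iota> \<longleftrightarrow>
     linear \<iota> \<and> range \<iota> \<subseteq> Rpow k \<and> \<iota> 1 \<noteq> 0 \<and> (\<forall>i<k. Poly_Mapping.lookup (\<iota> 1) i \<in> \<Gamma>)"

end

theory Submission
  imports Defs
begin

text \<open>
  Choose \<open>p = (p\<^sub>0, \<dots>, p\<^bsub>k-1\<^esub>)\<close> in \<open>\<Gamma>\<close>, linearly independent over \<open>\<rat>\<close>, whose \<open>\<rat>\<close>-span contains all
  slopes of \<open>\<Sigma>\<close>, and put \<open>\<iota> t = t p\<close>. After clearing denominators every inequality
  \<open>\<langle>u, w\<rangle> + \<gamma> t \<ge> 0\<close> is the restriction of an integral one, \<open>\<langle>u, w\<rangle> + f \<cdot> \<xi> \<ge> 0\<close>. Lift \<open>\<sigma>\<close> to the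
  cone cut out by the integral inequalities and by \<open>\<xi> \<in> C\<close>, where \<open>C\<close> is a small rational cone
  around \<open>p\<close>; the lifted fan consists of all faces of lifted cones.

  That \<open>\<sigma> \<inter> \<tau>\<close> is the face of \<open>\<sigma>\<close> on which the inequalities in \<open>J\<close> are tight means that finitely many
  integral systems in \<open>w\<close> are infeasible over \<open>\<xi> = p\<close>. By Fourier--Motzkin elimination feasibility
  over \<open>\<xi>\<close> amounts to integral homogeneous linear inequalities in \<open>\<xi>\<close>. As \<open>p\<close> satisfies no nontrivial
  integral linear equation, a violated one stays violated near \<open>p\<close>, so the lifted cones meet in the
  same way over all of \<open>C\<close>; over \<open>\<xi> = 0\<close> they meet as the cones of \<open>\<Sigma>\<close> do at height \<open>0\<close>.
\<close>

section \<open>Integral linear forms on real coordinate space\<close>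

definition idot :: "nat \<Rightarrow> (nat \<Rightarrow> int) \<Rightarrow> (nat \<Rightarrow> real) \<Rightarrow> real" where
  "idot k f x = (\<Sum>i<k. of_int (f i) * x i)"

lemma idot_cong: "(\<And>i. i < k \<Longrightarrow> x i = y i) \<Longrightarrow> idot k f x = idot k f y"
  by (simp add: idot_def)

lemma idot_scale: "idot k f (\<lambda>i. s * x i) = s * idot k f x"
  by (simp add: idot_def sum_distrib_left mult.left_commute)

lemma idot_uminus_left: "idot k (\<lambda>i. - f i) x = - idot k f x"
  by (simp add: idot_def sum_negf)

lemma idot_comb:
  "idot k (\<lambda>i. a * f i - b * g i) x = of_int a * idot k f x - of_int b * idot k g x"
  by (simp add: idot_def sum_distrib_left sum_subtractf algebra_simps)

lemma idot_single:
  assumes "j < k"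
  shows "idot k (\<lambda>i. if i = j then a else 0) x = of_int a * x j"
  using assms by (simp add: idot_def if_distrib[of of_int] if_distrib[of "\<lambda>c. c * _"] cong: if_cong)

section \<open>Fourier--Motzkin elimination\<close>

text \<open>Weak and strict inequalities are treated alike because an implication with conclusion
  \<open>form_val k g w p \<le> 0\<close> will be tested as infeasibility of a system with one
  strict member.\<close>

definition holds_pos :: "bool \<Rightarrow> real \<Rightarrow> bool" where
  "holds_pos strict v \<longleftrightarrow> (if strict then 0 < v else 0 \<le> v)"

text \<open>Members with \<open>\<alpha> c > 0\<close> bound \<open>z\<close> from below, those with
  \<open>\<alpha> c < 0\<close> from above, and \<open>z\<close> exists iff every lower bound is
  compatible with every upper one. Cross-multiplying instead of dividing keeps integral coefficients
  integral.\<close>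

lemma eliminate_real_variable:
  fixes \<alpha> \<beta> :: "'c \<Rightarrow> real"
  assumes "finite S"
  shows "(\<exists>z. \<forall>c\<in>S. holds_pos (st c) (\<beta> c + \<alpha> c * z)) \<longleftrightarrow>
    (\<forall>c\<in>S. \<alpha> c = 0 \<longrightarrow> holds_pos (st c) (\<beta> c)) \<and>
    (\<forall>c\<in>S. \<forall>d\<in>S. \<alpha> c > 0 \<longrightarrow> \<alpha> d < 0 \<longrightarrow> holds_pos (st c \<or> st d) (\<alpha> c * \<beta> d - \<alpha> d * \<beta> c))"
    (is "?L \<longleftrightarrow> ?R1 \<and> ?R2")
proof (intro iffI conjI)
  assume ?L
  then obtain z where z: "\<And>c. c \<in> S \<Longrightarrow> holds_pos (st c) (\<beta> c + \<alpha> c * z)" by blast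
  show ?R1 using z by force
  show ?R2
  proof (intro ballI impI)
    fix c d assume c: "c \<in> S" "\<alpha> c > 0" and d: "d \<in> S" "\<alpha> d < 0"
    \<comment> \<open>Positive multiples of the two inequalities whose sum no longer contains
      \<open>z\<close>.\<close>
    define x where "x = \<alpha> c * (\<beta> d + \<alpha> d * z)"
    define y where "y = (- \<alpha> d) * (\<beta> c + \<alpha> c * z)"
    have eq: "\<alpha> c * \<beta> d - \<alpha> d * \<beta> c = x + y"
      by (simp add: x_def y_def algebra_simps)
    have "holds_pos (st d) x" "holds_pos (st c) y"
      using z[OF c(1)] z[OF d(1)] c(2) d(2)
      by (simp_all add: x_def y_def holds_pos_def mult_neg_pos mult_nonpos_nonneg split: if_splits)
    then show "holds_pos (st c \<or> st d) (\<alpha> c * \<beta> d - \<alpha> d * \<beta> c)"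
      unfolding eq by (auto simp: holds_pos_def split: if_splits)
  qed
next
  assume R: "?R1 \<and> ?R2"
  \<comment> \<open>For \<open>\<alpha> c \<noteq> 0\<close> this is the value of \<open>z\<close>
    at which member \<open>c\<close> is an equality.\<close>
  define b where "b c = - \<beta> c / \<alpha> c" for c
  define L U where "L = b ` {c\<in>S. \<alpha> c > 0}" and "U = b ` {c\<in>S. \<alpha> c < 0}"
  have fin: "finite L" "finite U" using assms by (auto simp: L_def U_def)
  have cmp: "if st c \<or> st d then b c < b d else b c \<le> b d"
    if "c \<in> S" "\<alpha> c > 0" "d \<in> S" "\<alpha> d < 0" for c d
    using R that by (auto simp: b_def holds_pos_def field_simps split: if_splits)
  have LU: "x \<le> y" if "x \<in> L" "y \<in> U" for x y
    using that cmp by (fastforce simp: L_def U_def split: if_splits)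
  \<comment> \<open>Where a side has no bounds, an end is invented so that \<open>l < u\<close>.
    Hence \<open>l = u\<close> occurs only with both ends attained, and then \<open>cmp\<close>
    keeps the bound of any strict member off that value, so the midpoint works in every
    case.\<close>
  obtain l u where lu: "\<And>x. x \<in> L \<Longrightarrow> x \<le> l" "\<And>x. x \<in> U \<Longrightarrow> u \<le> x" "l \<le> u"
    "l < u \<or> l \<in> L \<and> u \<in> U"
  proof (cases "L = {}"; cases "U = {}")
    assume "L = {}" "U = {}" then show ?thesis by (intro that[of 0 1]) auto
  next
    assume "L = {}" "U \<noteq> {}" then show ?thesis
      using fin by (intro that[of "Min U - 1" "Min U"]) (auto simp: algebra_simps)
  next
    assume "L \<noteq> {}" "U = {}" then show ?thesis
      using fin by (intro that[of "Max L" "Max L + 1"]) auto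
  next
    assume "L \<noteq> {}" "U \<noteq> {}" then show ?thesis
      using fin LU by (intro that[of "Max L" "Min U"]) auto
  qed
  define z where "z = (l + u) / 2"
  have "holds_pos (st c) (\<beta> c + \<alpha> c * z)" if c: "c \<in> S" for c
  proof -
    consider "\<alpha> c = 0" | "\<alpha> c > 0" | "\<alpha> c < 0" by linarith
    then show ?thesis
    proof cases
      case 1 then show ?thesis using R c by simp
    next
      case 2
      have "b c \<le> l" using lu(1) 2 c by (auto simp: L_def)
      moreover have "b c < u" if "st c" "\<not> l < u"
        using cmp[OF c 2] lu(4) that by (auto simp: U_def)
      ultimately have "if st c then b c < z else b c \<le> z"
        using lu(3) unfolding z_def by (cases "l < u"; cases "st c") auto
      then show ?thesis using 2 by (auto simp: b_def holds_pos_def field_simps split: if_splits)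
    next
      case 3
      have "u \<le> b c" using lu(2) 3 c by (auto simp: U_def)
      moreover have "l < b c" if "st c" "\<not> l < u"
        using cmp[OF _ _ c 3] lu(4) that by (auto simp: L_def)
      ultimately have "if st c then z < b c else z \<le> b c"
        using lu(3) unfolding z_def by (cases "l < u"; cases "st c") auto
      then show ?thesis using 3 by (auto simp: b_def holds_pos_def field_simps split: if_splits)
    qed
  qed
  then show ?L by blast
qed

definition satisfies :: "nat \<Rightarrow> (nat \<Rightarrow> real) \<Rightarrow> (nat \<Rightarrow> int) \<times> bool \<Rightarrow> bool" where
  "satisfies m x c \<longleftrightarrow> holds_pos (snd c) (idot m (fst c) x)"

text \<open>Each pair with coefficients of opposite sign at \<open>m\<close> is combined by
  cross-multiplication, which stays integral and is strict if either partner is; members with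
  coefficient 0 are kept.\<close>

lemma eliminate_last_coordinate:
  assumes "finite S"
  shows "\<exists>S'. finite S' \<and>
    (\<forall>x. (\<forall>c\<in>S'. satisfies m x c) \<longleftrightarrow> (\<exists>z. \<forall>c\<in>S. satisfies (Suc m) (x(m := z)) c))"
proof -
  define comb :: "((nat \<Rightarrow> int) \<times> bool) \<times> ((nat \<Rightarrow> int) \<times> bool) \<Rightarrow> (nat \<Rightarrow> int) \<times> bool" where
    "comb = (\<lambda>(c, d). (\<lambda>i. fst c m * fst d i - fst d m * fst c i, snd c \<or> snd d))"
  define S' where "S' = {c\<in>S. fst c m = 0} \<union> comb ` {(c, d) \<in> S \<times> S. fst c m > 0 \<and> fst d m < 0}"
  have "finite S'" unfolding S'_def using assms
    by (auto intro!: finite_imageI intro: finite_subset[of _ "S \<times> S"])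
  moreover have "(\<forall>c\<in>S'. satisfies m x c) \<longleftrightarrow> (\<exists>z. \<forall>c\<in>S. satisfies (Suc m) (x(m := z)) c)" for x
  proof -
    have "satisfies (Suc m) (x(m := z)) c \<longleftrightarrow>
        holds_pos (snd c) (idot m (fst c) x + of_int (fst c m) * z)" for c z
      by (simp add: satisfies_def idot_def)
    moreover have "(\<forall>c\<in>S'. satisfies m x c) \<longleftrightarrow>
      (\<forall>c\<in>S. fst c m = 0 \<longrightarrow> satisfies m x c) \<and>
      (\<forall>c\<in>S. \<forall>d\<in>S. fst c m > 0 \<longrightarrow> fst d m < 0 \<longrightarrow> satisfies m x (comb (c, d)))"
      unfolding S'_def by blast
    ultimately show ?thesis
      using eliminate_real_variable[OF assms, of snd "\<lambda>c. idot m (fst c) x" "\<lambda>c. of_int (fst c m)"]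
      by (simp add: satisfies_def comb_def idot_comb)
  qed
  ultimately show ?thesis by blast
qed

text \<open>The last \<open>n\<close> coordinates are removed one at a time. The system changes in
  each round, so the induction runs over all \<open>S\<close>.\<close>

lemma eliminate_coordinates:
  assumes "finite S"
  shows "\<exists>S'. finite S' \<and>
    (\<forall>x. (\<forall>c\<in>S'. satisfies k x c) \<longleftrightarrow>
         (\<exists>y. (\<forall>i<k. y i = x i) \<and> (\<forall>c\<in>S. satisfies (k + n) y c)))"
  using assms
proof (induction n arbitrary: S)
  case 0
  have *: "satisfies k y c = satisfies k x c" if "\<forall>i<k. y i = x i" for x y c
    using that idot_cong[of k y x "fst c"] by (simp add: satisfies_def)
  have "(\<forall>c\<in>S. satisfies k x c) \<longleftrightarrow> (\<exists>y. (\<forall>i<k. y i = x i) \<and> (\<forall>c\<in>S. satisfies (k + 0) y c))" for x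
    using *[of _ x] by (metis add_0_right)
  then show ?case using 0 by blast
next
  case (Suc n)
  obtain T where T: "finite T" "\<And>x. (\<forall>c\<in>T. satisfies (k + n) x c) \<longleftrightarrow>
      (\<exists>z. \<forall>c\<in>S. satisfies (Suc (k + n)) (x(k + n := z)) c)"
    using eliminate_last_coordinate[OF Suc.prems, of "k + n"] by blast
  obtain S' where S': "finite S'" "\<And>x. (\<forall>c\<in>S'. satisfies k x c) \<longleftrightarrow>
         (\<exists>y. (\<forall>i<k. y i = x i) \<and> (\<forall>c\<in>T. satisfies (k + n) y c))"
    using Suc.IH[OF T(1)] by blast
  have "(\<exists>y. (\<forall>i<k. y i = x i) \<and> (\<forall>c\<in>T. satisfies (k + n) y c)) \<longleftrightarrow>
      (\<exists>y. (\<forall>i<k. y i = x i) \<and> (\<forall>c\<in>S. satisfies (k + Suc n) y c))" for x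
  proof
    assume "\<exists>y. (\<forall>i<k. y i = x i) \<and> (\<forall>c\<in>T. satisfies (k + n) y c)"
    then obtain y z where "\<forall>i<k. y i = x i" "\<forall>c\<in>S. satisfies (Suc (k + n)) (y(k + n := z)) c"
      using T(2) by blast
    then show "\<exists>y. (\<forall>i<k. y i = x i) \<and> (\<forall>c\<in>S. satisfies (k + Suc n) y c)"
      by (intro exI[of _ "y(k + n := z)"]) auto
  next
    assume "\<exists>y. (\<forall>i<k. y i = x i) \<and> (\<forall>c\<in>S. satisfies (k + Suc n) y c)"
    then obtain y where y: "\<forall>i<k. y i = x i" "\<forall>c\<in>S. satisfies (Suc (k + n)) y c" by auto
    then have "\<forall>c\<in>T. satisfies (k + n) y c"
      unfolding T(2) by (intro exI[of _ "y (k + n)"]) simp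
    then show "\<exists>y. (\<forall>i<k. y i = x i) \<and> (\<forall>c\<in>T. satisfies (k + n) y c)" using y(1) by blast
  qed
  then show ?case using S'(1) unfolding S'(2)[symmetric] by (intro exI[of _ S']) simp
qed

section \<open>Infeasibility near a generic point\<close>

text \<open>Neighbourhoods that constrain only the first \<open>k\<close> entries, given as a filter
  so that finitely many conditions near \<open>p\<close> combine by
  \<open>eventually\<close>.\<close>

definition box_nhds :: "nat \<Rightarrow> (nat \<Rightarrow> real) \<Rightarrow> (nat \<Rightarrow> real) filter" where
  "box_nhds k p = (INF \<delta>\<in>{0<..}. principal {x. \<forall>i<k. \<bar>x i - p i\<bar> \<le> \<delta>})"

lemma eventually_box_nhds:
  "eventually P (box_nhds k p) \<longleftrightarrow> (\<exists>\<delta>>0. \<forall>x. (\<forall>i<k. \<bar>x i - p i\<bar> \<le> \<delta>) \<longrightarrow> P x)"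
  unfolding box_nhds_def
proof (subst eventually_INF_base)
  fix a b :: real assume "a \<in> {0<..}" "b \<in> {0<..}"
  then show "\<exists>x\<in>{0<..}. principal {y. \<forall>i<k. \<bar>y i - p i\<bar> \<le> x}
      \<le> inf (principal {x. \<forall>i<k. \<bar>x i - p i\<bar> \<le> a}) (principal {x. \<forall>i<k. \<bar>x i - p i\<bar> \<le> b})"
    by (intro bexI[of _ "min a b"]) auto
qed (auto simp: eventually_principal)

lemma tendsto_coordinate_box_nhds:
  assumes "i < k" shows "((\<lambda>x. x i) \<longlongrightarrow> p i) (box_nhds k p)"
proof (rule tendstoI)
  fix e :: real assume "e > 0"
  then show "\<forall>\<^sub>F x in box_nhds k p. dist (x i) (p i) < e"
    unfolding eventually_box_nhds using assms
    by (intro exI[of _ "e / 2"]) (fastforce simp: dist_real_def)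
qed

lemma tendsto_idot_box_nhds: "(idot k f \<longlongrightarrow> idot k f p) (box_nhds k p)"
  unfolding idot_def by (intro tendsto_intros tendsto_coordinate_box_nhds) simp

text \<open>Linear independence over Q of the first \<open>k\<close> entries of \<open>p\<close>,
  with denominators cleared: \<open>p\<close> lies on no rational hyperplane through 0.\<close>

definition int_independent :: "nat \<Rightarrow> (nat \<Rightarrow> real) \<Rightarrow> bool" where
  "int_independent k p \<longleftrightarrow> (\<forall>f. idot k f p = 0 \<longrightarrow> (\<forall>i<k. f i = 0))"

text \<open>If the form vanishes at \<open>p\<close>, independence makes it zero everywhere, so the
  condition fails everywhere; otherwise its value at \<open>p\<close> is negative, which persists
  nearby. Thus no strict inequality can fail at \<open>p\<close> merely by equality and hold close
  by.\<close>

lemma eventually_not_satisfies: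
  assumes "int_independent k p" "\<not> satisfies k p c"
  shows "\<forall>\<^sub>F x in box_nhds k p. \<not> satisfies k x c"
proof (cases "idot k (fst c) p = 0")
  case True
  then have "idot k (fst c) x = 0" for x
    using assms(1) by (auto simp: int_independent_def idot_def)
  then show ?thesis using assms(2) by (simp add: satisfies_def)
next
  case False
  then have "idot k (fst c) p < 0"
    using assms(2) by (auto simp: satisfies_def holds_pos_def split: if_splits)
  then have "\<forall>\<^sub>F x in box_nhds k p. idot k (fst c) x < 0"
    by (rule order_tendstoD(2)[OF tendsto_idot_box_nhds])
  then show ?thesis by eventually_elim (auto simp: satisfies_def holds_pos_def)
qed

definition form_val :: "nat \<Rightarrow> ('v \<Rightarrow> real) \<times> (nat \<Rightarrow> int) \<Rightarrow> 'v \<Rightarrow> (nat \<Rightarrow> real) \<Rightarrow> real" where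
  "form_val k h w x = fst h w + idot k (snd h) x"

lemma idot_append:
  "idot (k + n) (\<lambda>i. if i < k then f i else g (i - k)) x = idot k f x + idot n g (\<lambda>j. x (k + j))"
  by (induction n) (auto simp: idot_def)

text \<open>In coordinates of a lattice basis, the forms of \<open>H\<close> being nonnegative and
  \<open>g\<close> positive is an integral system in \<open>k + n\<close> unknowns. Eliminating the
  coordinates of \<open>w\<close> leaves conditions on \<open>x\<close>; one of them fails at
  \<open>p\<close>, hence near \<open>p\<close>.\<close>

lemma eventually_infeasible:
  fixes N :: "'v::real_vector set"
  assumes N: "full_lattice N" and p: "int_independent k p"
    and H: "finite H" "fst ` H \<subseteq> dual_lattice N" and g: "fst g \<in> dual_lattice N"
    and imp: "\<And>w. (\<And>h. h \<in> H \<Longrightarrow> 0 \<le> form_val k h w p) \<Longrightarrow> form_val k g w p \<le> 0"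
  shows "\<forall>\<^sub>F x in box_nhds k p. \<forall>w. (\<forall>h\<in>H. 0 \<le> form_val k h w x) \<longrightarrow> form_val k g w x \<le> 0"
proof -
  obtain B where B: "finite B" "independent B" "span B = UNIV" "N = add_subgroup hull B"
    using N by (auto simp: full_lattice_def)
  obtain b where b: "bij_betw b {..<card B} B"
    using ex_bij_betw_nat_finite[OF B(1)] by (auto simp: atLeast0LessThan)
  define n where "n = card B"
  \<comment> \<open>The \<open>n\<close> entries of \<open>y\<close> from index \<open>k\<close> on
    serve as coordinates of \<open>w\<close> in the basis \<open>b\<close>.\<close>
  define vec where "vec y = (\<Sum>j<n. y (k + j) *\<^sub>R b j)" for y :: "nat \<Rightarrow> real"
  \<comment> \<open>The floor only changes the type: for \<open>fst h\<close> in the dual lattice,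
    \<open>fst h (b j)\<close> is an integer because \<open>b j\<close> lies in
    \<open>N\<close>.\<close>
  define coeffs where "coeffs h = (\<lambda>i. if i < k then snd h i else \<lfloor>fst h (b (i - k))\<rfloor>)"
    for h :: "('v \<Rightarrow> real) \<times> (nat \<Rightarrow> int)"
  have val: "idot (k + n) (coeffs h) y = form_val k h (vec y) y" if "fst h \<in> dual_lattice N" for h y
  proof -
    have lin: "linear (fst h)" using that by (simp add: dual_lattice_def)
    have "of_int \<lfloor>fst h (b j)\<rfloor> = fst h (b j)" if "j < n" for j
    proof -
      have "b j \<in> N" using b that hull_subset[of B add_subgroup]
        by (auto simp: B(4) n_def bij_betw_def)
      then show ?thesis using \<open>fst h \<in> dual_lattice N\<close> by (simp add: dual_lattice_def)
    qed
    then have "fst h (vec y) = idot n (\<lambda>j. \<lfloor>fst h (b j)\<rfloor>) (\<lambda>j. y (k + j))"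
      unfolding vec_def idot_def linear_sum[OF lin] linear_scale[OF lin] real_scaleR_def
      by (intro sum.cong refl) (metis lessThan_iff mult.commute)
    then show ?thesis
      unfolding coeffs_def form_val_def idot_append[of k n "snd h" "\<lambda>j. \<lfloor>fst h (b j)\<rfloor>"] by simp
  qed
  have ex_vec: "\<exists>y. (\<forall>i<k. y i = x i) \<and> vec y = w" for w x
  proof -
    obtain u where "w = (\<Sum>v\<in>B. u v *\<^sub>R v)"
      using B(3) unfolding span_finite[OF B(1)] by blast
    then have "w = (\<Sum>j<n. u (b j) *\<^sub>R b j)"
      using sum.reindex_bij_betw[OF b, of "\<lambda>v. u v *\<^sub>R v"] by (simp add: n_def)
    then show ?thesis
      by (intro exI[of _ "\<lambda>i. if i < k then x i else u (b (i - k))"]) (simp add: vec_def)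
  qed
  \<comment> \<open>The strict member is the negation of the conclusion about
    \<open>g\<close>.\<close>
  define S where "S = insert (coeffs g, True) ((\<lambda>h. (coeffs h, False)) ` H)"
  obtain S' where S': "finite S'" "\<And>x. (\<forall>c\<in>S'. satisfies k x c) \<longleftrightarrow>
         (\<exists>y. (\<forall>i<k. y i = x i) \<and> (\<forall>c\<in>S. satisfies (k + n) y c))"
    using eliminate_coordinates[of S k n] H(1) by (auto simp: S_def)
  have sat_S: "(\<forall>c\<in>S. satisfies (k + n) y c) \<longleftrightarrow>
      0 < form_val k g (vec y) x \<and> (\<forall>h\<in>H. 0 \<le> form_val k h (vec y) x)"
    if "\<forall>i<k. y i = x i" for x y
  proof -
    have "form_val k h w y = form_val k h w x" for h and w :: 'v
      using that idot_cong[of k y x "snd h"] by (simp add: form_val_def)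
    then show ?thesis using H(2) g by (auto simp: S_def satisfies_def holds_pos_def val image_subset_iff)
  qed
  have "\<not> (\<forall>c\<in>S'. satisfies k p c)"
  proof
    assume "\<forall>c\<in>S'. satisfies k p c"
    then obtain y where y: "\<forall>i<k. y i = p i" "\<forall>c\<in>S. satisfies (k + n) y c"
      unfolding S'(2) by blast
    then have "0 < form_val k g (vec y) p" "\<forall>h\<in>H. 0 \<le> form_val k h (vec y) p"
      using sat_S[OF y(1)] by auto
    then show False using imp[of "vec y"] by force
  qed
  then obtain c where "c \<in> S'" "\<not> satisfies k p c" by blast
  from eventually_not_satisfies[OF p this(2)] show ?thesis
  proof eventually_elim
    case (elim x)
    then have infeasible: "\<not> (\<exists>y. (\<forall>i<k. y i = x i) \<and> (\<forall>c\<in>S. satisfies (k + n) y c))"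
      using \<open>c \<in> S'\<close> S'(2) by blast
    show ?case
    proof (intro allI impI leI notI)
      fix w assume w: "\<forall>h\<in>H. 0 \<le> form_val k h w x" "0 < form_val k g w x"
      obtain y where "\<forall>i<k. y i = x i" "vec y = w" using ex_vec by blast
      with w sat_S[OF this(1)] infeasible show False by blast
    qed
  qed
qed

section \<open>Faces of polyhedral cones\<close>

text \<open>For linear forms on a subspace \<open>W\<close>, finite \<open>H\<close> and
  \<open>J \<subseteq> H\<close>, these are the nonempty faces of the cone with
  \<open>J = {}\<close>. The evaluation \<open>e\<close> is a parameter so that the same forms can
  be read on the lifted space and on its pullback.\<close>

definition tight_set :: "('h \<Rightarrow> 'a \<Rightarrow> real) \<Rightarrow> 'a set \<Rightarrow> 'h set \<Rightarrow> 'h set \<Rightarrow> 'a set" where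
  "tight_set e W H J = {x\<in>W. (\<forall>h\<in>H. 0 \<le> e h x) \<and> (\<forall>h\<in>J. e h x = 0)}"

lemma convex_cone_tight_set:
  assumes W: "subspace W" and lin: "\<And>h. h \<in> H \<union> J \<Longrightarrow> linear (e h)"
  shows "convex_cone (tight_set e W H J)"
  using subspace_0[OF W] subspace_add[OF W] subspace_scale[OF W]
    linear_0[OF lin] linear_add[OF lin] linear_scale[OF lin]
  by (auto simp: tight_set_def convex_cone_iff)

text \<open>A form that is nonnegative at both ends of a segment and zero at an inner point is zero
  at both ends.\<close>

lemma tight_set_face_of:
  assumes W: "subspace W" and lin: "\<And>h. h \<in> H \<Longrightarrow> linear (e h)" and J: "J \<subseteq> H"
  shows "tight_set e W H J face_of tight_set e W H {}"
  unfolding face_of_def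
proof (intro conjI ballI impI)
  show "convex (tight_set e W H J)"
    using convex_cone_tight_set[of W H J e] W lin J by (auto simp: convex_cone_def)
  fix a b x
  assume ab: "a \<in> tight_set e W H {}" "b \<in> tight_set e W H {}"
    and x: "x \<in> tight_set e W H J" "x \<in> open_segment a b"
  obtain u where u: "0 < u" "u < 1" "x = (1 - u) *\<^sub>R a + u *\<^sub>R b"
    using x(2) by (auto simp: in_segment)
  have "e h a = 0 \<and> e h b = 0" if h: "h \<in> J" for h
  proof -
    have l: "linear (e h)" using lin J h by auto
    have "(1 - u) * e h a + u * e h b = 0"
      using x(1) h linear_add[OF l, of "(1 - u) *\<^sub>R a" "u *\<^sub>R b"]
      by (simp add: u(3) tight_set_def linear_scale[OF l])
    moreover have "0 \<le> e h a" "0 \<le> e h b" using ab h J by (auto simp: tight_set_def)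
    ultimately show ?thesis using u(1,2)
      by (simp add: add_nonneg_eq_0_iff)
  qed
  then show "a \<in> tight_set e W H J" "b \<in> tight_set e W H J"
    using ab by (auto simp: tight_set_def)
qed (auto simp: tight_set_def)

lemma ex_small_multiple:
  fixes a c :: "'h \<Rightarrow> real"
  assumes "finite A" "\<And>h. h \<in> A \<Longrightarrow> 0 < c h"
  shows "\<exists>\<epsilon>>0. \<forall>h\<in>A. \<epsilon> * a h < c h"
proof -
  have "\<forall>\<^sub>F \<epsilon> in at_right 0. \<epsilon> * a h < c h" if "h \<in> A" for h
  proof (rule order_tendstoD(2))
    show "((\<lambda>\<epsilon>. \<epsilon> * a h) \<longlongrightarrow> 0 * a h) (at_right 0)" by (intro tendsto_intros)
  qed (use assms that in auto)
  then have "\<forall>\<^sub>F \<epsilon> in at_right 0. 0 < \<epsilon> \<and> (\<forall>h\<in>A. \<epsilon> * a h < c h)"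
    using assms(1) by (intro eventually_conj eventually_at_right_less eventually_ball_finite) auto
  then show ?thesis using eventually_happens'[of "at_right (0::real)"] by fastforce
qed

text \<open>\<open>J\<close> collects the forms vanishing on \<open>F\<close>. A point
  \<open>x\<close> of \<open>F\<close> where all other forms are positive acts as a relative
  interior point: for any \<open>y\<close> at which \<open>J\<close> is tight, the segment from
  \<open>y\<close> to \<open>x\<close> extends beyond \<open>x\<close> inside the cone, and the face
  property puts \<open>y\<close> in \<open>F\<close>.\<close>

lemma face_is_tight_set:
  assumes W: "subspace W" and H: "finite H" and lin: "\<And>h. h \<in> H \<Longrightarrow> linear (e h)"
    and F: "F face_of tight_set e W H {}" "F \<noteq> {}"
  shows "\<exists>J\<subseteq>H. F = tight_set e W H J"
proof -
  define J where "J = {h\<in>H. \<forall>x\<in>F. e h x = 0}"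
  have sub: "F \<subseteq> tight_set e W H {}" and cvx: "convex F" using F(1) by (auto simp: face_of_def)
  \<comment> \<open>Each form outside \<open>J\<close> is positive somewhere on \<open>F\<close>;
    midpoints merge these points into one.\<close>
  have "\<exists>x\<in>F. \<forall>h\<in>K. 0 < e h x" if "finite K" "K \<subseteq> H - J" for K
    using that
  proof (induction K)
    case empty then show ?case using F(2) by auto
  next
    case (insert h K)
    obtain x where x: "x \<in> F" "\<forall>h\<in>K. 0 < e h x" using insert by auto
    obtain x' where x': "x' \<in> F" "e h x' \<noteq> 0" using insert.prems by (auto simp: J_def)
    define m where "m = (1 / 2) *\<^sub>R x + (1 / 2) *\<^sub>R x'"
    have "m \<in> F" unfolding m_def using convexD[OF cvx x(1) x'(1)] by simp
    moreover have "0 < e g m" if g: "g \<in> insert h K" for g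
    proof -
      have gH: "g \<in> H" using g insert.prems by auto
      have "0 \<le> e g x" "0 \<le> e g x'" using x x' sub gH by (auto simp: tight_set_def)
      moreover have "0 < e g x \<or> e g x' \<noteq> 0" using g x(2) x'(2) by auto
      ultimately show ?thesis
        using lin[OF gH] by (auto simp: m_def linear_add linear_scale)
    qed
    ultimately show ?case by blast
  qed
  then obtain x where x: "x \<in> F" "\<And>h. h \<in> H - J \<Longrightarrow> 0 < e h x"
    using H by (metis finite_Diff subset_refl)
  have "y \<in> F" if y: "y \<in> tight_set e W H J" for y
  proof -
    obtain \<epsilon> where \<epsilon>: "0 < \<epsilon>" "\<And>h. h \<in> H - J \<Longrightarrow> \<epsilon> * e h y < e h x"
      using ex_small_multiple[of "H - J" "\<lambda>h. e h x" "\<lambda>h. e h y"] x(2) H by auto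
    \<comment> \<open>This is \<open>x\<close> moved by \<open>\<epsilon>\<close> times
      \<open>x - y\<close>, just past \<open>x\<close> on the line from \<open>y\<close>.\<close>
    define z where "z = (1 + \<epsilon>) *\<^sub>R x - \<epsilon> *\<^sub>R y"
    have xW: "x \<in> W" and yW: "y \<in> W" using x sub y by (auto simp: tight_set_def)
    have "0 \<le> e h z" if h: "h \<in> H" for h
    proof -
      have l: "linear (e h)" using lin h .
      have ez: "e h z = (1 + \<epsilon>) * e h x - \<epsilon> * e h y"
        unfolding z_def by (simp add: linear_diff[OF l] linear_scale[OF l])
      show ?thesis
      proof (cases "h \<in> J")
        case True
        then have "e h x = 0" "e h y = 0" using x(1) y by (auto simp: J_def tight_set_def)
        then show ?thesis by (simp add: ez)
      next
        case False
        then have "0 < e h x" "\<epsilon> * e h y < e h x" using x(2) \<epsilon>(2) h by auto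
        moreover have "0 < \<epsilon> * e h x" using calculation \<epsilon>(1) by simp
        ultimately show ?thesis by (simp add: ez algebra_simps)
      qed
    qed
    moreover have "z \<in> W" unfolding z_def
      using W xW yW by (intro subspace_diff subspace_scale)
    ultimately have zS: "z \<in> tight_set e W H {}" by (simp add: tight_set_def)
    show ?thesis
    \<comment> \<open>If \<open>z = y\<close> then \<open>x = y\<close>, and the open segment used
      in the other case would be empty.\<close>
    proof (cases "z = y")
      case True
      then have "(1 + \<epsilon>) *\<^sub>R x = (1 + \<epsilon>) *\<^sub>R y" by (simp add: z_def algebra_simps)
      then show ?thesis using \<epsilon>(1) x(1) by simp
    next
      case False
      have "(1 / (1 + \<epsilon>)) *\<^sub>R (z + \<epsilon> *\<^sub>R y) = x"
        using \<epsilon>(1) by (simp add: z_def)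
      moreover have "1 - \<epsilon> / (1 + \<epsilon>) = 1 / (1 + \<epsilon>)" using \<epsilon>(1) by (simp add: field_simps)
      ultimately have "x = (1 - \<epsilon> / (1 + \<epsilon>)) *\<^sub>R z + (\<epsilon> / (1 + \<epsilon>)) *\<^sub>R y"
        by (simp add: scaleR_add_right)
      then have "x \<in> open_segment z y"
        using False \<epsilon>(1) by (auto simp: in_segment intro!: exI[of _ "\<epsilon> / (1 + \<epsilon>)"])
      moreover have "y \<in> tight_set e W H {}" using y by (simp add: tight_set_def)
      ultimately show ?thesis using face_ofD[OF F(1)] zS x(1) by blast
    qed
  qed
  moreover have "F \<subseteq> tight_set e W H J" using sub by (auto simp: tight_set_def J_def)
  ultimately show ?thesis by (intro exI[of _ J]) (auto simp: J_def)
qed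

section \<open>Rational cones around a point\<close>

lemma ex_fraction_between:
  fixes x y :: real
  assumes "x < y"
  shows "\<exists>(a::int) (d::int). (0::int) < d \<and> x * d < a \<and> a < y * d"
proof -
  obtain r where "r \<in> \<rat>" "x < r" "r < y" using Rats_dense_in_real[OF assms] by auto
  moreover obtain a b :: int where "r = a / b" "b > 0"
    using \<open>r \<in> \<rat>\<close> by (meson Rats_cases')
  ultimately show ?thesis by (intro exI[of _ a] exI[of _ b]) (auto simp: field_simps)
qed

text \<open>The cone over a box with rational sides around \<open>p\<close> divided by
  \<open>p 0\<close>, in the slice \<open>x 0 = 1\<close>: the bounds \<open>a i / d i\<close> and
  \<open>b i / c i\<close> for \<open>x i / x 0\<close> become integral forms. A point of it with
  nonzero \<open>x 0\<close> rescales to one whose entry at 0 is \<open>p 0\<close>, and there it is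
  within \<open>\<delta>\<close> of \<open>p\<close>.\<close>

lemma rational_cone_inside_nbhd:
  assumes k: "0 < k" and p0: "0 < p 0" and P: "eventually P (box_nhds k p)"
  shows "\<exists>K. finite K \<and> (\<forall>f\<in>K. 0 \<le> idot k f p) \<and>
    (\<forall>x. (\<forall>f\<in>K. 0 \<le> idot k f x) \<longrightarrow>
         (\<forall>i<k. x i = 0) \<or> (\<exists>s>0. \<exists>y. P y \<and> x = (\<lambda>i. s * y i)))"
proof -
  obtain \<delta> where \<delta>: "\<delta> > 0" "\<And>x. (\<forall>i<k. \<bar>x i - p i\<bar> \<le> \<delta>) \<Longrightarrow> P x"
    using P by (auto simp: eventually_box_nhds)
  have "\<exists>(a::int) (d::int). (0::int) < d \<and> (p i - \<delta>) / p 0 * d < a \<and> a < p i / p 0 * d" for i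
    using \<delta>(1) p0 by (intro ex_fraction_between) (simp add: field_simps)
  then obtain a d :: "nat \<Rightarrow> int" where ad:
    "\<And>i. (0::int) < d i \<and> (p i - \<delta>) / p 0 * d i < a i \<and> a i < p i / p 0 * d i" by metis
  have "\<exists>(a::int) (d::int). (0::int) < d \<and> p i / p 0 * d < a \<and> a < (p i + \<delta>) / p 0 * d" for i
    using \<delta>(1) p0 by (intro ex_fraction_between) (simp add: field_simps)
  then obtain b c :: "nat \<Rightarrow> int" where bc:
    "\<And>i. (0::int) < c i \<and> p i / p 0 * c i < b i \<and> b i < (p i + \<delta>) / p 0 * c i" by metis
  define unit where "unit i = (\<lambda>j::nat. if j = i then 1 else 0 :: int)" for i :: nat
  define lo where "lo i = (\<lambda>j. d i * unit i j - a i * unit 0 j)" for i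
  define up where "up i = (\<lambda>j. b i * unit 0 j - c i * unit i j)" for i
  have lo: "idot k (lo i) x = of_int (d i) * x i - of_int (a i) * x 0"
    and up: "idot k (up i) x = of_int (b i) * x 0 - of_int (c i) * x i"
    if "i < k" for i and x :: "nat \<Rightarrow> real"
    using that k by (simp_all only: lo_def up_def idot_comb) (simp_all add: unit_def idot_single)
  show ?thesis
  proof (intro exI[of _ "lo ` {..<k} \<union> up ` {..<k}"] conjI allI impI)
    show "\<forall>f\<in>lo ` {..<k} \<union> up ` {..<k}. 0 \<le> idot k f p"
    proof -
      have "0 \<le> idot k (lo i) p \<and> 0 \<le> idot k (up i) p" if "i < k" for i
        using ad[of i] bc[of i] p0 unfolding lo[OF that] up[OF that] by (simp add: field_simps)
      then show ?thesis by blast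
    qed
    fix x :: "nat \<Rightarrow> real" assume "\<forall>f\<in>lo ` {..<k} \<union> up ` {..<k}. 0 \<le> idot k f x"
    then have x: "a i * x 0 \<le> d i * x i" "c i * x i \<le> b i * x 0" if "i < k" for i
      using that unfolding ball_Un ball_simps lessThan_iff by (force simp: lo up)+
    \<comment> \<open>For index 0 the lower bound reads \<open>(d 0 - a 0) * x 0 \<ge> 0\<close>,
      with a positive factor.\<close>
    have "of_int (a 0) < real_of_int (d 0)" using ad[of 0] p0 by simp
    then have "0 \<le> x 0" using x(1)[OF k] by (smt (verit) mult_strict_right_mono_neg)
    show "(\<forall>i<k. x i = 0) \<or> (\<exists>s>0. \<exists>y. P y \<and> x = (\<lambda>i. s * y i))"
    proof (cases "x 0 = 0")
      case True
      have "x i = 0" if "i < k" for i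
      proof -
        have "0 \<le> d i * x i" "c i * x i \<le> 0" using x[OF that] True by auto
        then show ?thesis using ad[of i] bc[of i]
          by (smt (verit) of_int_0_less_iff mult_pos_pos mult_pos_neg)
      qed
      then show ?thesis by blast
    next
      case False
      define s where "s = x 0 / p 0"
      have s: "s > 0" using False \<open>0 \<le> x 0\<close> p0 by (simp add: s_def)
      have x0: "x 0 = s * p 0" using p0 by (simp add: s_def)
      have "\<bar>x i / s - p i\<bar> \<le> \<delta>" if i: "i < k" for i
      proof -
        have "(p i - \<delta>) * d i < a i * p 0" using ad[of i] p0 by (simp add: field_simps)
        moreover have "a i * p 0 \<le> d i * (x i / s)"
          using x(1)[OF i] s by (simp add: x0 field_simps)
        ultimately have "p i - \<delta> < x i / s" using ad[of i]
          by (smt (verit) mult.commute mult_less_cancel_left_pos of_int_0_less_iff)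
        moreover have "b i * p 0 < (p i + \<delta>) * c i" using bc[of i] p0 by (simp add: field_simps)
        moreover have "c i * (x i / s) \<le> b i * p 0"
          using x(2)[OF i] s by (simp add: x0 field_simps)
        ultimately have "x i / s < p i + \<delta>" using bc[of i]
          by (smt (verit) mult.commute mult_less_cancel_left_pos of_int_0_less_iff)
        with \<open>p i - \<delta> < x i / s\<close> show ?thesis by linarith
      qed
      then have "P (\<lambda>i. x i / s)" by (intro \<delta>(2)) simp
      then show ?thesis using s by (intro disjI2 exI[of _ s] conjI exI[of _ "\<lambda>i. x i / s"]) auto
    qed
  qed simp
qed

section \<open>Rationally independent generators\<close>

text \<open>The entries of \<open>p\<close> are the absolute values of the elements of
  \<open>B\<close>: changing signs keeps them in \<open>\<Gamma>\<close>, preserves independence and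
  span, and makes \<open>p 0\<close> positive. An element of the span has rational coordinates,
  whose denominators \<open>m\<close> clears.\<close>

lemma ex_int_independent_point:
  assumes \<Gamma>: "add_subgroup \<Gamma>" and B: "finite B" "B \<subseteq> \<Gamma>" "rat_real.independent B" "B \<noteq> {}"
  shows "\<exists>k>0. \<exists>p. int_independent k p \<and> 0 < p 0 \<and> (\<forall>i<k. p i \<in> \<Gamma>) \<and>
    (\<forall>\<gamma>\<in>rat_real.span B. \<exists>m>0. \<exists>f. of_int m * \<gamma> = idot k f p)"
proof -
  define k where "k = card B"
  have k: "0 < k" using B by (simp add: k_def card_gt_0_iff)
  obtain b where b: "bij_betw b {..<k} B"
    using ex_bij_betw_nat_finite[OF B(1)] by (auto simp: atLeast0LessThan k_def)
  have bB: "b i \<in> B" if "i < k" for i using b that by (auto simp: bij_betw_def)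
  have b0: "b i \<noteq> 0" if "i < k" for i using bB[OF that] B(3) rat_real.dependent_zero by metis
  define p where "p = (\<lambda>i. \<bar>b i\<bar>)"
  define sg where "sg i = (if b i < 0 then -1 else 1 :: int)" for i
  have p_sg: "p i = of_int (sg i) * b i" for i by (simp add: p_def sg_def)
  have sg2: "sg i * sg i = 1" for i by (simp add: sg_def)
  have "int_independent k p"
    unfolding int_independent_def
  proof (intro allI impI)
    fix f i assume f: "idot k f p = 0" and i: "i < k"
    \<comment> \<open>The coefficients at \<open>p\<close>, carried back to \<open>B\<close> by the
      inverse of the enumeration and corrected by the signs.\<close>
    define u :: "real \<Rightarrow> rat" where "u v = of_int (f (the_inv_into {..<k} b v) * sg (the_inv_into {..<k} b v))" for v
    have u: "u (b j) = of_int (f j * sg j)" if "j < k" for j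
      using b that by (simp add: u_def the_inv_into_f_f bij_betw_def)
    have "(\<Sum>v\<in>B. of_rat (u v) * v) = (\<Sum>j<k. of_rat (u (b j)) * b j)"
      using sum.reindex_bij_betw[OF b, of "\<lambda>v. of_rat (u v) * v"] by simp
    also have "\<dots> = idot k f p"
      unfolding idot_def by (intro sum.cong) (auto simp: u p_sg of_rat_mult)
    finally have "(\<Sum>v\<in>B. of_rat (u v) * v) = 0" using f by simp
    then have "u (b i) = 0"
      using rat_real.dependent_finite[OF B(1)] B(3) bB[OF i] by blast
    then show "f i = 0" using u[OF i] sg2[of i] by auto
  qed
  moreover have "0 < p 0" using b0[OF k] by (simp add: p_def)
  moreover have "p i \<in> \<Gamma>" if "i < k" for i
    using bB[OF that] B(2) \<Gamma> by (auto simp: p_def add_subgroup_def abs_if)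
  moreover have "\<exists>m>0. \<exists>f. of_int m * \<gamma> = idot k f p" if "\<gamma> \<in> rat_real.span B" for \<gamma>
  proof -
    \<comment> \<open>The elements that become integral combinations of \<open>p\<close> after
      clearing denominators form a Q-subspace containing \<open>B\<close>.\<close>
    define X where "X = {\<gamma>. \<exists>m>0. \<exists>f. of_int m * \<gamma> = idot k f p}"
    have "rat_real.subspace X"
    proof (rule rat_real.subspaceI)
      show "0 \<in> X" unfolding X_def by (auto intro!: exI[of _ 1] exI[of _ "\<lambda>_. 0"] simp: idot_def)
    next
      fix x y assume "x \<in> X" "y \<in> X"
      then obtain m f n g where mn: "0 < m" "of_int m * x = idot k f p" "0 < n" "of_int n * y = idot k g p"
        by (auto simp: X_def)
      \<comment> \<open>\<open>idot_comb\<close> speaks of a difference, so the sum is written with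
        the coefficient \<open>- m\<close>.\<close>
      have "of_int (m * n) * (x + y) = idot k (\<lambda>i. n * f i - (- m) * g i) p"
        unfolding idot_comb by (simp add: mn(2,4)[symmetric] algebra_simps)
      then show "x + y \<in> X" unfolding X_def using mn(1,3)
        by (intro CollectI exI[of _ "m * n"]) auto
    next
      fix c :: rat and x assume "x \<in> X"
      then obtain m f where m: "0 < m" "of_int m * x = idot k f p" by (auto simp: X_def)
      obtain s t where q: "quotient_of c = (s, t)" by force
      then have c: "of_rat c = (of_int s / of_int t :: real)" "0 < t"
        using quotient_of_div[OF q] quotient_of_denom_pos[OF q] by (simp_all add: of_rat_divide)
      have "of_int (m * t) * (of_rat c * x) = idot k (\<lambda>i. s * f i - 0 * f i) p"
        unfolding idot_comb using c by (simp add: m(2)[symmetric] algebra_simps)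
      then show "of_rat c * x \<in> X" unfolding X_def using m(1) c(2)
        by (intro CollectI exI[of _ "m * t"]) auto
    qed
    moreover have "B \<subseteq> X"
    proof
      fix v assume "v \<in> B"
      then obtain i where i: "i < k" "v = b i" using b by (auto simp: bij_betw_def)
      have "of_int (sg i) * of_int (sg i) = (1::real)" by (simp add: sg_def)
      then have "of_int 1 * v = idot k (\<lambda>j. if j = i then sg i else 0) p"
        using i by (simp add: idot_single p_sg mult.assoc[symmetric])
      then show "v \<in> X" unfolding X_def by (intro CollectI exI[of _ 1]) auto
    qed
    ultimately show ?thesis using rat_real.span_minimal[of B X] that unfolding X_def by blast
  qed
  ultimately show ?thesis using k by blast
qed

section \<open>Lifting a fan\<close>

text \<open>With it an equation becomes two weak inequalities.\<close>

definition neg_form :: "('v \<Rightarrow> real) \<times> (nat \<Rightarrow> int) \<Rightarrow> ('v \<Rightarrow> real) \<times> (nat \<Rightarrow> int)" where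
  "neg_form h = (\<lambda>w. - fst h w, \<lambda>i. - snd h i)"

lemma form_val_neg_form [simp]: "form_val k (neg_form h) w x = - form_val k h w x"
  by (simp add: form_val_def neg_form_def idot_uminus_left)

lemma neg_form_dual_lattice: "fst h \<in> dual_lattice N \<Longrightarrow> fst (neg_form h) \<in> dual_lattice N"
  by (auto simp: neg_form_def dual_lattice_def linear_compose_neg)

lemma form_val_scale:
  assumes "linear (fst h)"
  shows "form_val k h (s *\<^sub>R w) (\<lambda>i. s * x i) = s * form_val k h w x"
  by (simp add: form_val_def idot_scale linear_scale[OF assms] algebra_simps)

lemma lookup_scaleR: "Poly_Mapping.lookup (r *\<^sub>R x) i = r * Poly_Mapping.lookup x i"
  for x :: "'i \<Rightarrow>\<^sub>0 real"
proof -
  have "finite {i. r *\<^sub>R Poly_Mapping.lookup x i \<noteq> 0}"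
    by (rule finite_subset[of _ "Poly_Mapping.keys x"]) (auto simp: in_keys_iff)
  then show ?thesis by (simp add: scaleR_poly_mapping_def)
qed

lemma in_Rpow_iff: "\<xi> \<in> Rpow k \<longleftrightarrow> (\<forall>i\<ge>k. Poly_Mapping.lookup \<xi> i = 0)"
  by (auto simp: Rpow_def subset_iff in_keys_iff not_less[symmetric])

lemma subspace_UNIV_Rpow: "subspace (UNIV \<times> Rpow k)"
  by (auto simp: subspace_def in_Rpow_iff lookup_add lookup_scaleR zero_prod_def)

definition form_at ::
    "nat \<Rightarrow> ('v \<Rightarrow> real) \<times> (nat \<Rightarrow> int) \<Rightarrow> 'v \<times> (nat \<Rightarrow>\<^sub>0 real) \<Rightarrow> real" where
  "form_at k h x = form_val k h (fst x) (Poly_Mapping.lookup (snd x))"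

lemma linear_form_at:
  assumes "fst h \<in> dual_lattice N"
  shows "linear (form_at k h)"
proof -
  have l: "linear (fst h)" using assms by (simp add: dual_lattice_def)
  show ?thesis
    by (rule linearI) (simp_all add: form_at_def form_val_def idot_def linear_add[OF l]
        linear_scale[OF l] lookup_add lookup_scaleR sum.distrib sum_distrib_left algebra_simps)
qed

lemma polyhedron_in_tight_set:
  assumes "finite H" "finite J" "\<And>h. h \<in> H \<union> J \<Longrightarrow> linear (e h)"
  shows "polyhedron_in W (tight_set e W H J)"
  unfolding polyhedron_in_def
proof (intro exI conjI)
  let ?D = "(\<lambda>h. (e h, 0)) ` H \<union> (\<lambda>h. (e h, 0)) ` J \<union> (\<lambda>h. (\<lambda>x. - e h x, 0 :: real)) ` J"
  show "finite ?D" using assms by auto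
  show "\<forall>(f, b)\<in>?D. linear f" using assms(3) by (auto intro: linear_compose_neg)
  show "tight_set e W H J = {x\<in>W. \<forall>(f, b)\<in>?D. b \<le> f x}"
    by (auto simp: tight_set_def ball_Un intro: order_antisym)
qed

lemma rational_cone_tight_set:
  assumes "finite H" "finite J" "fst ` (H \<union> J) \<subseteq> dual_lattice N"
  shows "rational_cone N k (tight_set (form_at k) (UNIV \<times> Rpow k) H J)"
  unfolding rational_cone_def
proof (intro exI conjI)
  let ?D = "H \<union> J \<union> neg_form ` J"
  show "finite ?D" using assms by auto
  have "fst h \<in> dual_lattice N" if "h \<in> ?D" for h
    using that assms(3) neg_form_dual_lattice[of _ N] by blast
  then show "\<forall>(u, f)\<in>?D. u \<in> dual_lattice N" unfolding case_prod_beta by blast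
  have "0 \<le> u w + (\<Sum>i<k. of_int (f i) * Poly_Mapping.lookup \<xi> i) \<longleftrightarrow> 0 \<le> form_at k (u, f) (w, \<xi>)"
    for u :: "'a \<Rightarrow> real" and f w \<xi>
    by (simp add: form_at_def form_val_def idot_def)
  moreover have "form_at k (neg_form h) x = - form_at k h x" for h and x :: "'a \<times> (nat \<Rightarrow>\<^sub>0 real)"
    by (simp add: form_at_def)
  ultimately show "tight_set (form_at k) (UNIV \<times> Rpow k) H J =
      {(w, \<xi>). \<xi> \<in> Rpow k \<and>
        (\<forall>(u, f)\<in>?D. 0 \<le> u w + (\<Sum>i<k. of_int (f i) * Poly_Mapping.lookup \<xi> i))}"
    by (auto simp: tight_set_def ball_Un intro: order_antisym)
qed

text \<open>The situation after clearing denominators: each cone is given by integral forms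
  evaluated at \<open>w\<close> and \<open>t\<close> times \<open>p\<close>. \<open>P\<close> is
  \<open>p\<close> as a point of \<open>Rpow k\<close>. The coordinate form with index 0 takes the
  value \<open>t * p 0\<close> there, so its presence among the forms encodes
  \<open>t \<ge> 0\<close>.\<close>

locale fan_lift =
  fixes N :: "'v::real_vector set" and k :: nat and p :: "nat \<Rightarrow> real"
    and P :: "nat \<Rightarrow>\<^sub>0 real" and \<Sigma> :: "('v \<times> real) set set"
    and H :: "('v \<times> real) set \<Rightarrow> (('v \<Rightarrow> real) \<times> (nat \<Rightarrow> int)) set"
  assumes lattice: "full_lattice N" and indep: "int_independent k p" and k: "0 < k" and p0: "0 < p 0"
    and lookup_P: "\<And>i. Poly_Mapping.lookup P i = (if i < k then p i else 0)"
    and fan: "fan_in UNIV \<Sigma>"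
    and finH: "\<And>\<sigma>. \<sigma> \<in> \<Sigma> \<Longrightarrow> finite (H \<sigma>)"
    and dualH: "\<And>\<sigma>. \<sigma> \<in> \<Sigma> \<Longrightarrow> fst ` H \<sigma> \<subseteq> dual_lattice N"
    and heightH: "\<And>\<sigma>. \<sigma> \<in> \<Sigma> \<Longrightarrow> ((\<lambda>_. 0), (\<lambda>i. if i = 0 then 1 else 0)) \<in> H \<sigma>"
    and cone_eq: "\<And>\<sigma>. \<sigma> \<in> \<Sigma> \<Longrightarrow>
      \<sigma> = {x. \<forall>h\<in>H \<sigma>. 0 \<le> form_val k h (fst x) (\<lambda>i. snd x * p i)}"
begin

abbreviation height :: "('v \<Rightarrow> real) \<times> (nat \<Rightarrow> int)" where
  "height \<equiv> ((\<lambda>_. 0), (\<lambda>i. if i = 0 then 1 else 0))"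

abbreviation \<phi> :: "'v \<times> real \<Rightarrow> 'v \<times> (nat \<Rightarrow>\<^sub>0 real)" where
  "\<phi> \<equiv> map_prod id (\<lambda>t. t *\<^sub>R P)"

abbreviation V :: "('v \<times> (nat \<Rightarrow>\<^sub>0 real)) set" where
  "V \<equiv> UNIV \<times> Rpow k"

lemma form_at_\<phi>: "form_at k h (\<phi> x) = form_val k h (fst x) (\<lambda>i. snd x * p i)"
  unfolding form_at_def form_val_def
  by (simp, rule idot_cong) (simp add: lookup_scaleR lookup_P)

lemma form_at_height: "form_at k height x = Poly_Mapping.lookup (snd x) 0"
  using k by (simp add: form_at_def form_val_def idot_single)

lemma form_at_height_\<phi>: "form_at k height (\<phi> x) = snd x * p 0"
  using k by (simp add: form_at_height lookup_scaleR lookup_P)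

lemma \<phi>_in_V: "\<phi> x \<in> V"
  by (cases x) (simp add: in_Rpow_iff lookup_scaleR lookup_P)

lemma linear_\<phi>: "linear \<phi>"
  by (rule linearI) (auto simp: scaleR_add_left)

lemma linear_form_at_\<phi>: "fst h \<in> dual_lattice N \<Longrightarrow> linear (\<lambda>x. form_at k h (\<phi> x))"
  using linear_compose[OF linear_\<phi> linear_form_at] by (simp add: o_def)

lemma cone_eq_tight_set: "\<sigma> \<in> \<Sigma> \<Longrightarrow> \<sigma> = tight_set (\<lambda>h x. form_at k h (\<phi> x)) UNIV (H \<sigma>) {}"
  using cone_eq[of \<sigma>] by (simp add: tight_set_def form_at_\<phi>)

lemma mem_iff: "\<sigma> \<in> \<Sigma> \<Longrightarrow> x \<in> \<sigma> \<longleftrightarrow> (\<forall>h\<in>H \<sigma>. 0 \<le> form_at k h (\<phi> x))"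
  using cone_eq[of \<sigma>] by (auto simp: form_at_\<phi>)

lemma complex: "polyhedral_complex UNIV \<Sigma>"
  and strongly_convex: "\<sigma> \<in> \<Sigma> \<Longrightarrow> strongly_convex_cone \<sigma>"
  using fan by (auto simp: fan_in_def)

lemma zero_in: "\<sigma> \<in> \<Sigma> \<Longrightarrow> 0 \<in> \<sigma>"
  using strongly_convex by (auto simp: strongly_convex_cone_def convex_cone_iff)

lemma finite_fan: "finite \<Sigma>"
  using complex by (simp add: polyhedral_complex_def)

text \<open>All ways to exhibit the intersection as a face of \<open>\<sigma>\<close>. For cones of
  the fan they are finite in number, so conditions can be imposed for all of them at once.\<close>

definition tight_form_sets :: "('v \<times> real) set \<Rightarrow> ('v \<times> real) set \<Rightarrow> (('v \<Rightarrow> real) \<times> (nat \<Rightarrow> int)) set set" where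
  "tight_form_sets \<sigma> \<tau> =
     {J. J \<subseteq> H \<sigma> \<and> \<sigma> \<inter> \<tau> = tight_set (\<lambda>h x. form_at k h (\<phi> x)) UNIV (H \<sigma>) J}"

text \<open>All cones contain 0, so the intersection is a nonempty face of
  \<open>\<sigma>\<close>.\<close>

lemma tight_form_sets_nonempty:
  assumes "\<sigma> \<in> \<Sigma>" "\<tau> \<in> \<Sigma>"
  shows "tight_form_sets \<sigma> \<tau> \<noteq> {}"
proof -
  have ne: "\<sigma> \<inter> \<tau> \<noteq> {}" using zero_in assms by blast
  then have "(\<sigma> \<inter> \<tau>) face_of \<sigma>"
    using complex assms unfolding polyhedral_complex_def by blast
  then have "(\<sigma> \<inter> \<tau>) face_of tight_set (\<lambda>h x. form_at k h (\<phi> x)) UNIV (H \<sigma>) {}"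
    using cone_eq_tight_set[OF assms(1)] by simp
  then obtain J where "J \<subseteq> H \<sigma>" "\<sigma> \<inter> \<tau> = tight_set (\<lambda>h x. form_at k h (\<phi> x)) UNIV (H \<sigma>) J"
    using face_is_tight_set[of UNIV "H \<sigma>" "\<lambda>h x. form_at k h (\<phi> x)", OF subspace_UNIV
        finH[OF assms(1)] linear_form_at_\<phi> _ ne] dualH[OF assms(1)] by blast
  then show ?thesis by (auto simp: tight_form_sets_def)
qed

text \<open>
  The fibres over \<open>y\<close> of the lifted cones meet as the slices of \<open>\<Sigma>\<close> at height 1 do. When
  \<open>height \<in> J\<close>, i.e. \<open>\<sigma> \<inter> \<tau>\<close> has empty slice, the first conjunct forces the fibres over \<open>y\<close> with
  \<open>0 < y 0\<close> to be disjoint.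
\<close>

definition meets_alike :: "(nat \<Rightarrow> real) \<Rightarrow> bool" where
  "meets_alike y \<longleftrightarrow> (\<forall>\<sigma>\<in>\<Sigma>. \<forall>\<tau>\<in>\<Sigma>. \<forall>J\<in>tight_form_sets \<sigma> \<tau>.
     (\<forall>h\<in>J. \<forall>w. (\<forall>h'\<in>H \<sigma> \<union> H \<tau>. 0 \<le> form_val k h' w y) \<longrightarrow> form_val k h w y \<le> 0) \<and>
     (\<forall>g\<in>H \<tau>. \<forall>w. (\<forall>h\<in>H \<sigma> \<union> neg_form ` J. 0 \<le> form_val k h w y) \<longrightarrow>
        form_val k (neg_form g) w y \<le> 0))"

text \<open>Over \<open>p\<close> both kinds of implication express how \<open>\<sigma>\<close> and
  \<open>\<tau>\<close> meet at height 1. They are finite in number, and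
  \<open>eventually_infeasible\<close> spreads each of them to a neighbourhood.\<close>

lemma eventually_meets_alike: "\<forall>\<^sub>F y in box_nhds k p. meets_alike y"
  unfolding meets_alike_def
proof (intro eventually_ball_finite ballI eventually_conj)
  show "finite \<Sigma>" "finite \<Sigma>" by (fact finite_fan)+
  fix \<sigma> \<tau> assume \<sigma>: "\<sigma> \<in> \<Sigma>" and \<tau>: "\<tau> \<in> \<Sigma>"
  have "tight_form_sets \<sigma> \<tau> \<subseteq> Pow (H \<sigma>)" by (auto simp: tight_form_sets_def)
  then show "finite (tight_form_sets \<sigma> \<tau>)" using finH[OF \<sigma>] by (meson finite_Pow_iff finite_subset)
  show "finite (H \<tau>)" using finH[OF \<tau>] .
  fix J assume J: "J \<in> tight_form_sets \<sigma> \<tau>"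
  then have JH: "J \<subseteq> H \<sigma>" by (simp add: tight_form_sets_def)
  show "finite J" using finite_subset[OF JH finH[OF \<sigma>]] .
  have dual: "fst ` H \<sigma> \<subseteq> dual_lattice N" "fst ` H \<tau> \<subseteq> dual_lattice N"
    using dualH \<sigma> \<tau> by auto
  have slice: "form_val k h w p = form_at k h (\<phi> (w, 1))" for h w
    unfolding form_at_\<phi> by simp
  have mem: "(w, 1) \<in> \<rho> \<longleftrightarrow> (\<forall>h\<in>H \<rho>. 0 \<le> form_val k h w p)" if "\<rho> \<in> \<Sigma>" for w \<rho>
    unfolding mem_iff[OF that] slice ..
  have meet: "(w, 1) \<in> \<sigma> \<inter> \<tau> \<longleftrightarrow>
      (\<forall>h\<in>H \<sigma>. 0 \<le> form_val k h w p) \<and> (\<forall>h\<in>J. form_val k h w p = 0)" for w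
    using J unfolding slice by (simp add: tight_form_sets_def tight_set_def)
  show "\<forall>\<^sub>F y in box_nhds k p. \<forall>w.
      (\<forall>h'\<in>H \<sigma> \<union> H \<tau>. 0 \<le> form_val k h' w y) \<longrightarrow> form_val k h w y \<le> 0" if "h \<in> J" for h
  proof (rule eventually_infeasible[OF lattice indep])
    show "finite (H \<sigma> \<union> H \<tau>)" using finH \<sigma> \<tau> by auto
    show "fst ` (H \<sigma> \<union> H \<tau>) \<subseteq> dual_lattice N" "fst h \<in> dual_lattice N"
      using dual JH that by blast+
    show "form_val k h w p \<le> 0" if "\<And>h'. h' \<in> H \<sigma> \<union> H \<tau> \<Longrightarrow> 0 \<le> form_val k h' w p" for w
      using meet[of w] mem[OF \<sigma>] mem[OF \<tau>] that \<open>h \<in> J\<close> by auto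
  qed
  show "\<forall>\<^sub>F y in box_nhds k p. \<forall>w.
      (\<forall>h\<in>H \<sigma> \<union> neg_form ` J. 0 \<le> form_val k h w y) \<longrightarrow> form_val k (neg_form g) w y \<le> 0"
    if "g \<in> H \<tau>" for g
  proof (rule eventually_infeasible[OF lattice indep])
    show "finite (H \<sigma> \<union> neg_form ` J)" using finH \<sigma> \<open>finite J\<close> by auto
    show "fst ` (H \<sigma> \<union> neg_form ` J) \<subseteq> dual_lattice N" "fst (neg_form g) \<in> dual_lattice N"
      using dual JH that neg_form_dual_lattice[of _ N] by blast+
    show "form_val k (neg_form g) w p \<le> 0"
      if w: "\<And>h. h \<in> H \<sigma> \<union> neg_form ` J \<Longrightarrow> 0 \<le> form_val k h w p" for w
    proof -
      have "form_val k h w p = 0" if "h \<in> J" for h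
        using w[of h] w[of "neg_form h"] that JH by fastforce
      then have "(w, 1) \<in> \<tau>" using meet[of w] w by blast
      then show ?thesis using mem[OF \<tau>] \<open>g \<in> H \<tau>\<close> by auto
    qed
  qed
qed

section \<open>Lifted cones and the fan of their faces\<close>

lemma ex_rational_cone:
  "\<exists>K. finite K \<and> (\<forall>f\<in>K. 0 \<le> idot k f p) \<and>
    (\<forall>x. (\<forall>f\<in>K. 0 \<le> idot k f x) \<longrightarrow>
         (\<forall>i<k. x i = 0) \<or> (\<exists>s>0. \<exists>y. (0 < y 0 \<and> meets_alike y) \<and> x = (\<lambda>i. s * y i)))"
proof (rule rational_cone_inside_nbhd[of k p, OF k p0])
  show "\<forall>\<^sub>F y in box_nhds k p. 0 < y 0 \<and> meets_alike y"
    using order_tendstoD(1)[OF tendsto_coordinate_box_nhds[of 0 k p, OF k] p0] eventually_meets_alike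
    by (rule eventually_conj)
qed

text \<open>The integral forms cutting out the cone \<open>C\<close> around \<open>p\<close>, fixed
  once for the whole fan.\<close>

definition K :: "(nat \<Rightarrow> int) set" where
  "K = (SOME K. finite K \<and> (\<forall>f\<in>K. 0 \<le> idot k f p) \<and>
    (\<forall>x. (\<forall>f\<in>K. 0 \<le> idot k f x) \<longrightarrow>
         (\<forall>i<k. x i = 0) \<or> (\<exists>s>0. \<exists>y. (0 < y 0 \<and> meets_alike y) \<and> x = (\<lambda>i. s * y i))))"

lemma finite_K: "finite K" and K_p: "f \<in> K \<Longrightarrow> 0 \<le> idot k f p"
  and K_cases: "(\<And>f. f \<in> K \<Longrightarrow> 0 \<le> idot k f x) \<Longrightarrow>
    (\<forall>i<k. x i = 0) \<or> (\<exists>s>0. \<exists>y. (0 < y 0 \<and> meets_alike y) \<and> x = (\<lambda>i. s * y i))"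
  using someI_ex[OF ex_rational_cone] unfolding K_def[symmetric] by blast+

definition G :: "('v \<times> real) set \<Rightarrow> (('v \<Rightarrow> real) \<times> (nat \<Rightarrow> int)) set" where
  "G \<sigma> = H \<sigma> \<union> (\<lambda>f. ((\<lambda>_. 0), f)) ` K"

definition lift_cone :: "('v \<times> real) set \<Rightarrow> ('v \<times> (nat \<Rightarrow>\<^sub>0 real)) set" where
  "lift_cone \<sigma> = tight_set (form_at k) V (G \<sigma>) {}"

definition lift_fan :: "('v \<times> (nat \<Rightarrow>\<^sub>0 real)) set set" where
  "lift_fan = {F. \<exists>\<sigma>\<in>\<Sigma>. F face_of lift_cone \<sigma> \<and> F \<noteq> {}}"

lemma finG: "\<sigma> \<in> \<Sigma> \<Longrightarrow> finite (G \<sigma>)"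
  using finH finite_K by (simp add: G_def)

lemma dualG: "\<sigma> \<in> \<Sigma> \<Longrightarrow> h \<in> G \<sigma> \<Longrightarrow> fst h \<in> dual_lattice N"
  using dualH[of \<sigma>] by (auto simp: G_def dual_lattice_def linear_zero)

text \<open>The forms of \<open>K\<close> are nonnegative at \<open>t\<close> times \<open>p\<close>
  for \<open>t \<ge> 0\<close>, and \<open>height\<close> already enforces \<open>t \<ge> 0\<close>;
  so adding them changes nothing below.\<close>

lemma tight_set_G:
  assumes "\<sigma> \<in> \<Sigma>"
  shows "tight_set (\<lambda>h x. form_at k h (\<phi> x)) UNIV (G \<sigma>) J =
    tight_set (\<lambda>h x. form_at k h (\<phi> x)) UNIV (H \<sigma>) J"
proof -
  have "0 \<le> form_at k ((\<lambda>_. 0), f) (\<phi> x)" if "0 \<le> form_at k height (\<phi> x)" "f \<in> K" for f x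
  proof -
    have "0 \<le> snd x" using that(1) p0 by (simp add: form_at_height_\<phi> zero_le_mult_iff)
    then show ?thesis using K_p[OF that(2)] by (simp add: form_at_\<phi> form_val_def idot_scale)
  qed
  then show ?thesis using heightH[OF assms] by (auto simp: tight_set_def G_def)
qed

text \<open>A set \<open>J\<close> that cuts \<open>\<sigma> \<inter> \<tau>\<close> out of
  \<open>\<sigma>\<close> does the same for the lifted cones. This is checked in each fibre over
  \<open>C\<close>: over 0 it is the statement at height 0, elsewhere the base point is a positive
  multiple of some \<open>y\<close> with \<open>meets_alike y\<close>.\<close>

lemma lift_cone_meet_face:
  assumes \<sigma>: "\<sigma> \<in> \<Sigma>" and \<tau>: "\<tau> \<in> \<Sigma>"
  shows "(lift_cone \<sigma> \<inter> lift_cone \<tau>) face_of lift_cone \<sigma>"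
proof -
  obtain J where J: "J \<in> tight_form_sets \<sigma> \<tau>" using tight_form_sets_nonempty[OF \<sigma> \<tau>] by auto
  then have JH: "J \<subseteq> H \<sigma>"
    and meet: "\<sigma> \<inter> \<tau> = tight_set (\<lambda>h x. form_at k h (\<phi> x)) UNIV (H \<sigma>) J"
    by (auto simp: tight_form_sets_def)
  have *: "(\<forall>h\<in>H \<sigma> \<union> H \<tau>. 0 \<le> form_at k h x) \<longleftrightarrow>
      (\<forall>h\<in>H \<sigma>. 0 \<le> form_at k h x) \<and> (\<forall>h\<in>J. form_at k h x = 0)"
    if K: "\<And>f. f \<in> K \<Longrightarrow> 0 \<le> idot k f (Poly_Mapping.lookup (snd x))" for x
    using K_cases[OF K]
  proof
    assume "\<forall>i<k. Poly_Mapping.lookup (snd x) i = 0"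
    then have at_0: "form_at k h (\<phi> (fst x, 0)) = form_at k h x" for h
      unfolding form_at_\<phi> by (simp add: form_at_def form_val_def idot_def)
    have "(\<forall>h\<in>H \<rho>. 0 \<le> form_at k h x) \<longleftrightarrow> (fst x, 0) \<in> \<rho>" if "\<rho> \<in> \<Sigma>" for \<rho>
      by (simp only: mem_iff[OF that] at_0)
    moreover have "(\<forall>h\<in>H \<sigma>. 0 \<le> form_at k h x) \<and> (\<forall>h\<in>J. form_at k h x = 0)
        \<longleftrightarrow> (fst x, 0) \<in> \<sigma> \<inter> \<tau>"
      by (simp only: meet tight_set_def mem_Collect_eq UNIV_I at_0 simp_thms)
    ultimately show ?thesis using \<sigma> \<tau> by auto
  next
    assume "\<exists>s>0. \<exists>y. (0 < y 0 \<and> meets_alike y) \<and> Poly_Mapping.lookup (snd x) = (\<lambda>i. s * y i)"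
    then obtain s y where s: "s > 0" and y: "meets_alike y"
      and x: "Poly_Mapping.lookup (snd x) = (\<lambda>i. s * y i)" by blast
    \<comment> \<open>Rescaling moves the fibre over \<open>s\<close> times \<open>y\<close> to the
      fibre over \<open>y\<close>, where \<open>meets_alike\<close> applies.\<close>
    define w where "w = (1 / s) *\<^sub>R fst x"
    have w: "fst x = s *\<^sub>R w" using s by (simp add: w_def)
    have scale: "form_at k h x = s * form_val k h w y" if "h \<in> H \<sigma> \<union> H \<tau>" for h
    proof -
      have "linear (fst h)" using that dualH \<sigma> \<tau> by (auto simp: dual_lattice_def)
      then show ?thesis by (simp add: form_at_def w x form_val_scale)
    qed
    have alike:
      "(\<forall>h\<in>H \<sigma> \<union> H \<tau>. 0 \<le> form_val k h w y) \<Longrightarrow> h \<in> J \<Longrightarrow> form_val k h w y \<le> 0"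
      "(\<forall>h\<in>H \<sigma> \<union> neg_form ` J. 0 \<le> form_val k h w y) \<Longrightarrow> h \<in> H \<tau> \<Longrightarrow> 0 \<le> form_val k h w y" for h
      using y J \<sigma> \<tau> by (auto simp: meets_alike_def)
    have "(\<forall>h\<in>H \<sigma> \<union> H \<tau>. 0 \<le> form_val k h w y) \<longleftrightarrow>
        (\<forall>h\<in>H \<sigma>. 0 \<le> form_val k h w y) \<and> (\<forall>h\<in>J. form_val k h w y = 0)"
    proof (intro iffI conjI ballI)
      fix h assume L: "\<forall>h\<in>H \<sigma> \<union> H \<tau>. 0 \<le> form_val k h w y" and h: "h \<in> J"
      then have "0 \<le> form_val k h w y" using JH by auto
      then show "form_val k h w y = 0" using alike(1)[OF L h] by simp
    next
      fix h assume R: "(\<forall>h\<in>H \<sigma>. 0 \<le> form_val k h w y) \<and> (\<forall>h\<in>J. form_val k h w y = 0)"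
        and h: "h \<in> H \<sigma> \<union> H \<tau>"
      then have "\<forall>h\<in>H \<sigma> \<union> neg_form ` J. 0 \<le> form_val k h w y" by auto
      then show "0 \<le> form_val k h w y" using alike(2) R h by blast
    qed auto
    moreover have "0 \<le> form_at k h x \<longleftrightarrow> 0 \<le> form_val k h w y"
      "form_at k h x = 0 \<longleftrightarrow> form_val k h w y = 0" if "h \<in> H \<sigma> \<union> H \<tau>" for h
      using scale[OF that] s by (simp_all add: zero_le_mult_iff)
    ultimately show ?thesis using JH by blast
  qed
  have "lift_cone \<sigma> \<inter> lift_cone \<tau> = tight_set (form_at k) V (G \<sigma>) J"
  proof (intro set_eqI)
    fix x :: "'v \<times> (nat \<Rightarrow>\<^sub>0 real)"
    have "form_at k ((\<lambda>_. 0), f) x = idot k f (Poly_Mapping.lookup (snd x))" for f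
      by (simp add: form_at_def form_val_def)
    then show "x \<in> lift_cone \<sigma> \<inter> lift_cone \<tau> \<longleftrightarrow> x \<in> tight_set (form_at k) V (G \<sigma>) J"
      using *[of x] by (auto simp: lift_cone_def tight_set_def G_def ball_Un)
  qed
  moreover have "tight_set (form_at k) V (G \<sigma>) J face_of lift_cone \<sigma>"
    unfolding lift_cone_def
    by (rule tight_set_face_of[OF subspace_UNIV_Rpow linear_form_at[OF dualG[OF \<sigma>]]])
      (use JH in \<open>auto simp: G_def\<close>)
  ultimately show ?thesis by simp
qed

lemma lift_fan_cases:
  assumes "F \<in> lift_fan"
  obtains \<sigma> J where "\<sigma> \<in> \<Sigma>" "J \<subseteq> G \<sigma>" "F = tight_set (form_at k) V (G \<sigma>) J"
proof -
  obtain \<sigma> where \<sigma>: "\<sigma> \<in> \<Sigma>" "F face_of tight_set (form_at k) V (G \<sigma>) {}" "F \<noteq> {}"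
    using assms by (auto simp: lift_fan_def lift_cone_def)
  then show ?thesis
    using face_is_tight_set[OF subspace_UNIV_Rpow finG[OF \<sigma>(1)] linear_form_at[OF dualG[OF \<sigma>(1)]] \<sigma>(2,3)]
      that by blast
qed

lemma convex_cone_lift: "\<sigma> \<in> \<Sigma> \<Longrightarrow> J \<subseteq> G \<sigma> \<Longrightarrow> convex_cone (tight_set (form_at k) V (G \<sigma>) J)"
  using linear_form_at dualG by (intro convex_cone_tight_set subspace_UNIV_Rpow) blast

text \<open>A linear form bounded below along a line is constant on it, so all forms vanish at the
  direction \<open>d\<close>. Since \<open>height\<close> is positive at the nonzero points of
  \<open>C\<close>, the second component of \<open>d\<close> is 0, and \<open>d\<close> spans a line
  in \<open>\<sigma>\<close> at height 0.\<close>

lemma lift_cone_no_line: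
  assumes \<sigma>: "\<sigma> \<in> \<Sigma>"
  shows "\<not> contains_line (lift_cone \<sigma>)"
proof
  assume "contains_line (lift_cone \<sigma>)"
  then obtain a d where d: "d \<noteq> 0" "\<And>t. a + t *\<^sub>R d \<in> lift_cone \<sigma>"
    unfolding contains_line_def by blast
  have zero: "form_at k h d = 0" if "h \<in> G \<sigma>" for h
  proof (rule ccontr)
    assume nz: "form_at k h d \<noteq> 0"
    have l: "linear (form_at k h)" using linear_form_at dualG[OF \<sigma> that] .
    have "0 \<le> form_at k h a + t * form_at k h d" for t
    proof -
      have "0 \<le> form_at k h (a + t *\<^sub>R d)"
        using d(2)[of t] that unfolding lift_cone_def tight_set_def by blast
      then show ?thesis by (simp add: linear_add[OF l] linear_scale[OF l])
    qed
    \<comment> \<open>At this \<open>t\<close> the value would be -1.\<close>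
    from this[of "- (form_at k h a + 1) / form_at k h d"] show False using nz by simp
  qed
  have "a \<in> V" "a + d \<in> V" using d(2)[of 0] d(2)[of 1] by (auto simp: lift_cone_def tight_set_def)
  then have "d \<in> V" using subspace_diff[OF subspace_UNIV_Rpow, of "a + d" k a] by simp
  have "0 \<le> idot k f (Poly_Mapping.lookup (snd d))" if "f \<in> K" for f
    using zero[of "((\<lambda>_. 0), f)"] that by (simp add: G_def form_at_def form_val_def)
  from K_cases[OF this] have "\<forall>i<k. Poly_Mapping.lookup (snd d) i = 0"
  proof
    assume "\<exists>s>0. \<exists>y. (0 < y 0 \<and> meets_alike y) \<and> Poly_Mapping.lookup (snd d) = (\<lambda>i. s * y i)"
    then obtain s y where "s > 0" "0 < y 0" "Poly_Mapping.lookup (snd d) 0 = s * y 0" by auto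
    moreover have "form_at k height d = 0" using zero heightH[OF \<sigma>] by (simp add: G_def)
    ultimately show ?thesis by (simp add: form_at_height)
  qed
  then have "Poly_Mapping.lookup (snd d) i = 0" for i
    using \<open>d \<in> V\<close> by (cases "i < k") (auto simp: in_Rpow_iff mem_Times_iff)
  then have "snd d = 0" by (intro poly_mapping_eqI) simp
  then have d_eq: "d = \<phi> (fst d, 0)" by (simp add: prod_eq_iff)
  have "t *\<^sub>R (fst d, 0) \<in> \<sigma>" for t
  proof -
    have "form_at k h (\<phi> (t *\<^sub>R (fst d, 0))) = 0" if "h \<in> H \<sigma>" for h
    proof -
      have l: "linear (\<lambda>x. form_at k h (\<phi> x))"
        using linear_form_at_\<phi> dualG[OF \<sigma>] that by (auto simp: G_def)
      show ?thesis using linear_scale[OF l, of t "(fst d, 0)"] zero[of h] that d_eq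
        by (simp add: G_def)
    qed
    then show ?thesis unfolding mem_iff[OF \<sigma>] by force
  qed
  moreover have "(fst d, 0 :: real) \<noteq> 0" using d(1) \<open>snd d = 0\<close> by (auto simp: prod_eq_iff)
  ultimately have "contains_line \<sigma>"
    unfolding contains_line_def by (intro exI[of _ 0] exI[of _ "(fst d, 0)"]) simp
  then show False using strongly_convex[OF \<sigma>] by (simp add: strongly_convex_cone_def)
qed

lemma lift_cone_in_lift_fan: "\<sigma> \<in> \<Sigma> \<Longrightarrow> lift_cone \<sigma> \<in> lift_fan"
  using convex_cone_lift[of \<sigma> "{}"] face_of_refl[of "lift_cone \<sigma>"]
  unfolding lift_fan_def lift_cone_def convex_cone_def by blast

text \<open>The traces of \<open>F\<close> and \<open>F'\<close> on the common face
  \<open>?M\<close> of the two lifted cones are faces of \<open>?M\<close>. So they meet in a face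
  of \<open>?M\<close>, hence of \<open>lift_cone \<sigma>\<close>; lying in \<open>F\<close>, it is
  a face of \<open>F\<close>.\<close>

lemma lift_fan_meet:
  assumes "F \<in> lift_fan" "F' \<in> lift_fan"
  shows "(F \<inter> F') face_of F"
proof -
  obtain \<sigma> \<tau> where F: "\<sigma> \<in> \<Sigma>" "F face_of lift_cone \<sigma>" and F': "\<tau> \<in> \<Sigma>" "F' face_of lift_cone \<tau>"
    using assms by (auto simp: lift_fan_def)
  let ?M = "lift_cone \<sigma> \<inter> lift_cone \<tau>"
  have M: "?M face_of lift_cone \<sigma>" "?M face_of lift_cone \<tau>"
    using lift_cone_meet_face F(1) F'(1) by (metis Int_commute)+
  have "F \<inter> ?M face_of lift_cone \<sigma>" "F' \<inter> ?M face_of lift_cone \<tau>"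
    using F(2) F'(2) M by (auto intro: face_of_Int)
  then have "F \<inter> ?M face_of ?M" "F' \<inter> ?M face_of ?M"
    using face_of_face[OF M(1)] face_of_face[OF M(2)] by auto
  then have "(F \<inter> ?M) \<inter> (F' \<inter> ?M) face_of lift_cone \<sigma>"
    using M(1) by (meson face_of_Int face_of_trans)
  moreover have "(F \<inter> ?M) \<inter> (F' \<inter> ?M) = F \<inter> F'"
    using F(2) F'(2) by (auto dest: face_of_imp_subset)
  ultimately show ?thesis using face_of_face[OF F(2)] by simp
qed

lemma rational_lift_fan: "rational_fan N k lift_fan"
  unfolding rational_fan_def fan_in_def polyhedral_complex_def
proof (intro conjI ballI)
  show "lift_fan \<noteq> {}" using fan lift_cone_in_lift_fan by (auto simp: fan_in_def)
  \<comment> \<open>A member is determined by a cone of \<open>\<Sigma>\<close> and a set of tight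
    forms.\<close>
  have "lift_fan \<subseteq> (\<Union>\<sigma>\<in>\<Sigma>. tight_set (form_at k) V (G \<sigma>) ` Pow (G \<sigma>))"
    by (auto elim!: lift_fan_cases)
  then show "finite lift_fan"
    by (rule finite_subset) (auto intro!: finite_UN_I finite_fan finG)
  fix F assume F: "F \<in> lift_fan"
  then obtain \<sigma> J where \<sigma>: "\<sigma> \<in> \<Sigma>" "J \<subseteq> G \<sigma>" "F = tight_set (form_at k) V (G \<sigma>) J"
    by (rule lift_fan_cases)
  have fin: "finite (G \<sigma>)" "finite J" using finG[OF \<sigma>(1)] \<sigma>(2) finite_subset by auto
  have dual: "fst ` (G \<sigma> \<union> J) \<subseteq> dual_lattice N" using dualG[OF \<sigma>(1)] \<sigma>(2) by auto
  show "polyhedron_in V F" unfolding \<sigma>(3)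
    using dual by (intro polyhedron_in_tight_set fin linear_form_at) blast
  show "rational_cone N k F" unfolding \<sigma>(3) using rational_cone_tight_set[OF fin dual] .
  have "F \<subseteq> lift_cone \<sigma>" by (auto simp: \<sigma>(3) lift_cone_def tight_set_def)
  then have "\<not> contains_line F"
    using lift_cone_no_line[OF \<sigma>(1)] unfolding contains_line_def by blast
  then show "strongly_convex_cone F"
    using convex_cone_lift[OF \<sigma>(1,2)] \<sigma>(3) by (simp add: strongly_convex_cone_def)
  show "\<forall>E. E face_of F \<and> E \<noteq> {} \<longrightarrow> E \<in> lift_fan"
    using F unfolding lift_fan_def by (blast intro: face_of_trans)
  show "F \<inter> F' = {} \<or> (F \<inter> F') face_of F \<and> (F \<inter> F') face_of F'" if "F' \<in> lift_fan" for F'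
    using lift_fan_meet[OF F that] lift_fan_meet[OF that F] by (simp add: Int_commute)
qed

lemma vimage_tight_set: "\<phi> -` tight_set (form_at k) V A J = tight_set (\<lambda>h x. form_at k h (\<phi> x)) UNIV A J"
  using \<phi>_in_V by (auto simp: tight_set_def)

lemma nonneg_snd:
  assumes "\<sigma> \<in> \<Sigma>" shows "\<sigma> \<subseteq> UNIV \<times> {0..}"
proof
  fix x assume "x \<in> \<sigma>"
  then have "0 \<le> snd x * p 0"
    using heightH[OF assms] unfolding mem_iff[OF assms] form_at_height_\<phi>[symmetric] by blast
  then show "x \<in> UNIV \<times> {0..}" using p0 by (simp add: mem_Times_iff zero_le_mult_iff)
qed

text \<open>Each \<open>\<sigma>\<close> is recovered from its lifted cone. Conversely, a face with
  tight forms \<open>J\<close> pulls back to the face of \<open>\<sigma>\<close> with the same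
  \<open>J\<close>, and restricting to height 0 adds \<open>height\<close> to \<open>J\<close>;
  \<open>\<Sigma>\<close> is closed under faces.\<close>

lemma pullback_lift_fan: "fan_pullback \<phi> lift_fan = \<Sigma>"
proof (intro equalityI subsetI)
  fix \<sigma> assume \<sigma>: "\<sigma> \<in> \<Sigma>"
  have "\<phi> -` lift_cone \<sigma> = \<sigma>"
    using cone_eq_tight_set[OF \<sigma>] by (simp only: lift_cone_def vimage_tight_set tight_set_G[OF \<sigma>])
  then have "\<phi> -` lift_cone \<sigma> \<inter> UNIV \<times> {0..} = \<sigma>" using nonneg_snd[OF \<sigma>] by auto
  then show "\<sigma> \<in> fan_pullback \<phi> lift_fan"
    using lift_cone_in_lift_fan[OF \<sigma>] unfolding fan_pullback_def by blast
next
  fix \<rho> assume "\<rho> \<in> fan_pullback \<phi> lift_fan"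
  then obtain F where F: "F \<in> lift_fan"
    and \<rho>: "\<rho> = \<phi> -` F \<inter> UNIV \<times> {0..} \<or> \<rho> = \<phi> -` F \<inter> UNIV \<times> {0}"
    by (auto simp: fan_pullback_def)
  obtain \<sigma> J where \<sigma>: "\<sigma> \<in> \<Sigma>" "J \<subseteq> G \<sigma>" "F = tight_set (form_at k) V (G \<sigma>) J"
    using F by (rule lift_fan_cases)
  let ?T = "tight_set (\<lambda>h x. form_at k h (\<phi> x)) UNIV (G \<sigma>)"
  have T0: "?T {} = \<sigma>" using cone_eq_tight_set[OF \<sigma>(1)] tight_set_G[OF \<sigma>(1)] by simp
  have face: "?T I \<in> \<Sigma>" if "I \<subseteq> G \<sigma>" for I
  proof -
    have lin: "linear (\<lambda>x. form_at k h (\<phi> x))" if "h \<in> G \<sigma>" for h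
      using linear_form_at_\<phi> dualG[OF \<sigma>(1) that] .
    have "?T I face_of \<sigma>"
      using tight_set_face_of[of UNIV "G \<sigma>" "\<lambda>h x. form_at k h (\<phi> x)" I, OF subspace_UNIV lin that]
      unfolding T0 by blast
    moreover have "?T I \<noteq> {}"
      using convex_cone_tight_set[OF subspace_UNIV, of "G \<sigma>" I "\<lambda>h x. form_at k h (\<phi> x)"] lin that
      by (auto simp: convex_cone_def)
    ultimately show ?thesis using complex \<sigma>(1) by (auto simp: polyhedral_complex_def)
  qed
  have pre: "\<phi> -` F = ?T J" by (simp only: \<sigma>(3) vimage_tight_set)
  from \<rho> show "\<rho> \<in> \<Sigma>"
  proof
    assume "\<rho> = \<phi> -` F \<inter> UNIV \<times> {0..}"
    moreover have "?T J \<subseteq> UNIV \<times> {0..}"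
      using nonneg_snd[OF face[OF \<sigma>(2)]] .
    ultimately have "\<rho> = ?T J" using pre by auto
    then show ?thesis using face[OF \<sigma>(2)] by simp
  next
    assume "\<rho> = \<phi> -` F \<inter> UNIV \<times> {0}"
    moreover have "?T J \<inter> UNIV \<times> {0} = ?T (insert height J)"
      using p0 by (auto simp: tight_set_def form_at_height_\<phi>)
    ultimately have "\<rho> = ?T (insert height J)" using pre by simp
    moreover have "insert height J \<subseteq> G \<sigma>" using \<sigma>(2) heightH[OF \<sigma>(1)] by (auto simp: G_def)
    ultimately show ?thesis using face by simp
  qed
qed

end

section \<open>From admissible fans to integral data\<close>

lemma admissible_fan_inequalities:
  assumes "admissible_fan N \<Gamma> \<Sigma>" "\<sigma> \<in> \<Sigma>"
  shows "\<exists>A. finite A \<and> A \<subseteq> dual_lattice N \<times> \<Gamma> \<and>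
    \<sigma> = {(w, t). 0 \<le> t \<and> (\<forall>(u, \<gamma>)\<in>A. 0 \<le> u w + \<gamma> * t)}"
proof -
  have "admissible_cone N \<Gamma> \<sigma>" using assms unfolding admissible_fan_def by simp
  then show ?thesis unfolding admissible_cone_def by (rule conjunct2)
qed

text \<open>Multiplying an inequality of slope \<open>\<gamma>\<close> by the positive integer
  \<open>m \<gamma>\<close> keeps its solutions and makes the slope an integral combination of
  \<open>p\<close>. With the form for \<open>t \<ge> 0\<close> added, \<open>fan_lift\<close>
  applies.\<close>

lemma admissible_fan_is_pullback:
  fixes N :: "'v::real_vector set"
  assumes N: "full_lattice N" and p: "int_independent k p" "0 < k" "0 < p 0"
    and P: "\<And>i. Poly_Mapping.lookup P i = (if i < k then p i else 0)"
    and \<Gamma>: "\<And>\<gamma>. \<gamma> \<in> \<Gamma> \<Longrightarrow> \<exists>m>0. \<exists>f. of_int m * \<gamma> = idot k f p"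
    and \<Sigma>: "admissible_fan N \<Gamma> \<Sigma>"
  shows "\<exists>\<Sigma>'. rational_fan N k \<Sigma>' \<and> \<Sigma> = fan_pullback (map_prod id (\<lambda>t. t *\<^sub>R P)) \<Sigma>'"
proof -
  let ?height = "((\<lambda>_. 0), (\<lambda>i. if i = 0 then 1 else 0)) :: ('v \<Rightarrow> real) \<times> (nat \<Rightarrow> int)"
  have "\<exists>m. \<forall>\<gamma>\<in>\<Gamma>. (0::int) < m \<gamma> \<and> (\<exists>f. of_int (m \<gamma>) * \<gamma> = idot k f p)"
    using \<Gamma> by (intro bchoice) auto
  then obtain m where m: "\<And>\<gamma>. \<gamma> \<in> \<Gamma> \<Longrightarrow> (0::int) < m \<gamma>"
    "\<forall>\<gamma>\<in>\<Gamma>. \<exists>f. of_int (m \<gamma>) * \<gamma> = idot k f p" by blast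
  have "\<exists>F. \<forall>\<gamma>\<in>\<Gamma>. of_int (m \<gamma>) * \<gamma> = idot k (F \<gamma>) p"
    using m(2) by (rule bchoice)
  then obtain F where F: "\<forall>\<gamma>\<in>\<Gamma>. of_int (m \<gamma>) * \<gamma> = idot k (F \<gamma>) p" ..
  define conv where "conv h = ((\<lambda>w. of_int (m (snd h)) * fst h w), F (snd h))"
    for h :: "('v \<Rightarrow> real) \<times> real"
  have "\<exists>H. finite H \<and> fst ` H \<subseteq> dual_lattice N \<and> ?height \<in> H \<and>
      \<sigma> = {x. \<forall>h\<in>H. 0 \<le> form_val k h (fst x) (\<lambda>i. snd x * p i)}" if \<sigma>: "\<sigma> \<in> \<Sigma>" for \<sigma>
  proof -
    obtain A where A: "finite A" "A \<subseteq> dual_lattice N \<times> \<Gamma>"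
      "\<sigma> = {(w, t). 0 \<le> t \<and> (\<forall>(u, \<gamma>)\<in>A. 0 \<le> u w + \<gamma> * t)}"
      using admissible_fan_inequalities[OF \<Sigma> \<sigma>] by (elim exE conjE)
    have conv: "0 \<le> form_val k (conv (u, \<gamma>)) w (\<lambda>i. t * p i) \<longleftrightarrow> 0 \<le> u w + \<gamma> * t"
      if "(u, \<gamma>) \<in> A" for u \<gamma> w t
    proof -
      have \<gamma>: "0 < m \<gamma>" "of_int (m \<gamma>) * \<gamma> = idot k (F \<gamma>) p" using m(1) F A(2) that by auto
      have "form_val k (conv (u, \<gamma>)) w (\<lambda>i. t * p i) = of_int (m \<gamma>) * (u w + \<gamma> * t)"
        by (simp add: conv_def form_val_def idot_scale \<gamma>(2)[symmetric] algebra_simps)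
      then show ?thesis using \<gamma>(1) by (simp add: zero_le_mult_iff)
    qed
    have height: "0 \<le> form_val k ?height w (\<lambda>i. t * p i) \<longleftrightarrow> 0 \<le> t" for w t
      using p by (simp add: form_val_def idot_single zero_le_mult_iff)
    show ?thesis
    proof (intro exI[of _ "insert ?height (conv ` A)"] conjI)
      have "(\<lambda>w. of_int n * u w) \<in> dual_lattice N" if "u \<in> dual_lattice N" for u n
        using that by (auto simp: dual_lattice_def intro!: linear_compose_scale_right[where f = u, simplified])
      then show "fst ` insert ?height (conv ` A) \<subseteq> dual_lattice N"
        using A(2) by (auto simp: conv_def dual_lattice_def linear_zero)
      show "\<sigma> = {x. \<forall>h\<in>insert ?height (conv ` A). 0 \<le> form_val k h (fst x) (\<lambda>i. snd x * p i)}"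
        unfolding A(3) using conv height by (fastforce simp: ball_simps)
    qed (use A in auto)
  qed
  then have "\<exists>H. \<forall>\<sigma>\<in>\<Sigma>. finite (H \<sigma>) \<and> fst ` H \<sigma> \<subseteq> dual_lattice N \<and> ?height \<in> H \<sigma> \<and>
      \<sigma> = {x. \<forall>h\<in>H \<sigma>. 0 \<le> form_val k h (fst x) (\<lambda>i. snd x * p i)}"
    by (intro bchoice ballI)
  then obtain H where H: "\<forall>\<sigma>\<in>\<Sigma>. finite (H \<sigma>) \<and> fst ` H \<sigma> \<subseteq> dual_lattice N \<and> ?height \<in> H \<sigma> \<and>
      \<sigma> = {x. \<forall>h\<in>H \<sigma>. 0 \<le> form_val k h (fst x) (\<lambda>i. snd x * p i)}" ..
  have "fan_in UNIV \<Sigma>" using \<Sigma> by (simp add: admissible_fan_def)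
  then interpret fan_lift N k p P \<Sigma> H
    using N p P H by unfold_locales blast+
  show ?thesis using rational_lift_fan pullback_lift_fan by metis
qed

lemma ex_ray_map:
  assumes "0 < k" "p 0 \<noteq> 0" "\<And>i. i < k \<Longrightarrow> p i \<in> \<Gamma>"
  shows "\<exists>P. (\<forall>i. Poly_Mapping.lookup P i = (if i < k then p i else 0)) \<and>
    ray_map \<Gamma> k (\<lambda>t. t *\<^sub>R P)"
proof -
  define P where "P = Abs_poly_mapping (\<lambda>i. if i < k then p i else 0)"
  have "finite {i. (if i < k then p i else 0) \<noteq> 0}"
    by (rule finite_subset[of _ "{..<k}"]) auto
  then have P: "Poly_Mapping.lookup P i = (if i < k then p i else 0)" for i by (simp add: P_def)
  moreover have "P \<noteq> 0" using P[of 0] assms by auto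
  moreover have "range (\<lambda>t. t *\<^sub>R P) \<subseteq> Rpow k" by (auto simp: in_Rpow_iff lookup_scaleR P)
  moreover have "linear (\<lambda>t. t *\<^sub>R P)" by (rule linearI) (auto simp: scaleR_add_left)
  ultimately show ?thesis using assms(3) by (intro exI[of _ P]) (auto simp: ray_map_def)
qed

text \<open>Both parts of the theorem come from this, with \<open>S\<close> a finite set of slopes
  or all of \<open>\<Gamma>\<close>. A maximal independent subset \<open>B'\<close> of
  \<open>S\<close> is finite because \<open>S\<close> lies in a finite-dimensional span; lying
  inside \<open>S\<close>, it supplies a point with entries in \<open>\<Gamma>\<close>. It is chosen
  before \<open>\<Sigma>\<close>, so \<open>k\<close> and \<open>\<iota>\<close> do not depend on
  \<open>\<Sigma>\<close>.\<close>

lemma ex_ray_map_for_span: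
  fixes N :: "'v::real_vector set"
  assumes N: "full_lattice N" and \<Gamma>: "add_subgroup \<Gamma>"
    and S: "S \<subseteq> \<Gamma>" "\<not> S \<subseteq> {0}" and B: "finite B" "S \<subseteq> rat_real.span B"
  shows "\<exists>k>0. \<exists>\<iota>. ray_map \<Gamma> k \<iota> \<and>
    (\<forall>\<Sigma>. admissible_fan N S \<Sigma> \<longrightarrow>
      (\<exists>\<Sigma>'. rational_fan N k \<Sigma>' \<and> \<Sigma> = fan_pullback (map_prod id \<iota>) \<Sigma>'))"
proof -
  obtain B' where B': "B' \<subseteq> S" "rat_real.independent B'" "S \<subseteq> rat_real.span B'"
    using rat_real.maximal_independent_subset[of S] by blast
  then have "finite B'" using rat_real.independent_span_bound[OF B(1) B'(2)] B(2) by blast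
  \<comment> \<open>Otherwise \<open>S\<close> would lie in the span of the empty set, which is
    \<open>{0}\<close>.\<close>
  moreover have "B' \<noteq> {}" using B'(3) S(2) rat_real.span_empty by auto
  ultimately obtain k p where kp: "0 < k" "int_independent k p" "0 < p 0" "\<forall>i<k. p i \<in> \<Gamma>"
    "\<forall>\<gamma>\<in>rat_real.span B'. \<exists>m>0. \<exists>f. of_int m * \<gamma> = idot k f p"
    using ex_int_independent_point[OF \<Gamma> _ _ B'(2)] B'(1) S(1) by (metis subset_trans)
  obtain P where "\<And>i. Poly_Mapping.lookup P i = (if i < k then p i else 0)"
    "ray_map \<Gamma> k (\<lambda>t. t *\<^sub>R P)"
    using ex_ray_map[of k p \<Gamma>] kp by auto
  then show ?thesis
    using admissible_fan_is_pullback[OF N kp(2,1,3), of P S] kp(1,5) B'(3) by blast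
qed

text \<open>A fan has finitely many cones, each with finitely many inequalities. Keeping only their
  slopes replaces \<open>\<Gamma>\<close>, whose rational span may have infinite dimension, by a
  finite set.\<close>

lemma admissible_fan_finitely_many_slopes:
  assumes "admissible_fan N \<Gamma> \<Sigma>"
  shows "\<exists>S\<subseteq>\<Gamma>. finite S \<and> admissible_fan N S \<Sigma>"
proof -
  have "\<exists>A. \<forall>\<sigma>\<in>\<Sigma>. finite (A \<sigma>) \<and> A \<sigma> \<subseteq> dual_lattice N \<times> \<Gamma> \<and>
      \<sigma> = {(w, t). 0 \<le> t \<and> (\<forall>(u, \<gamma>)\<in>A \<sigma>. 0 \<le> u w + \<gamma> * t)}"
    by (intro bchoice ballI admissible_fan_inequalities[OF assms])
  then obtain A where "\<forall>\<sigma>\<in>\<Sigma>. finite (A \<sigma>) \<and> A \<sigma> \<subseteq> dual_lattice N \<times> \<Gamma> \<and>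
      \<sigma> = {(w, t). 0 \<le> t \<and> (\<forall>(u, \<gamma>)\<in>A \<sigma>. 0 \<le> u w + \<gamma> * t)}" ..
  note A_all = bspec[OF this]
  note A = conjunct1[OF A_all] conjunct1[OF conjunct2[OF A_all]]
    and eq = conjunct2[OF conjunct2[OF A_all]]
  define S where "S = (\<Union>\<sigma>\<in>\<Sigma>. snd ` A \<sigma>)"
  have fan: "fan_in UNIV \<Sigma>" using assms by (simp add: admissible_fan_def)
  have "finite S" using A fan by (auto simp: S_def fan_in_def polyhedral_complex_def)
  moreover have "S \<subseteq> \<Gamma>" using A by (fastforce simp: S_def)
  moreover have "admissible_cone N S \<sigma>" if "\<sigma> \<in> \<Sigma>" for \<sigma>
    unfolding admissible_cone_def
  proof (intro conjI exI[of _ "A \<sigma>"])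
    show "strongly_convex_cone \<sigma>" using fan that by (simp add: fan_in_def)
    show "A \<sigma> \<subseteq> dual_lattice N \<times> S" using A that by (force simp: S_def)
  qed (rule A(1)[OF that], rule eq[OF that])
  ultimately show ?thesis using assms by (auto simp: admissible_fan_def)
qed

lemma admissible_fan_mono: "admissible_fan N S \<Sigma> \<Longrightarrow> S \<subseteq> T \<Longrightarrow> admissible_fan N T \<Sigma>"
  unfolding admissible_fan_def admissible_cone_def by (meson Sigma_mono order_refl subset_trans)

text \<open>Brings the finitely generated case under the finite-dimensional one: the generators span
  a space containing the group.\<close>

lemma add_subgroup_hull_subset_rat_span: "add_subgroup hull S \<subseteq> rat_real.span S"
proof (rule hull_minimal)
  show "add_subgroup (rat_real.span S)"
    by (simp add: add_subgroup_def rat_real.span_zero rat_real.span_add rat_real.span_neg)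
qed (rule rat_real.span_superset)

theorem theorem1p3:
  fixes N :: "'v::real_vector set" and \<Gamma> :: "real set"
  assumes "full_lattice N"
    and "add_subgroup \<Gamma>" and "\<Gamma> \<noteq> {0}"
  shows
    "(\<forall>\<Sigma>. admissible_fan N \<Gamma> \<Sigma> \<longrightarrow>
        (\<exists>k>0. \<exists>\<Sigma>' \<iota>. rational_fan N k \<Sigma>' \<and> ray_map \<Gamma> k \<iota> \<and>
            \<Sigma> = fan_pullback (map_prod id \<iota>) \<Sigma>'))
     \<and> (fg_subgroup \<Gamma> \<or> fin_dim_divisible_hull \<Gamma> \<longrightarrow>
        (\<exists>k>0. \<exists>\<iota>. ray_map \<Gamma> k \<iota> \<and>
            (\<forall>\<Sigma>. admissible_fan N \<Gamma> \<Sigma> \<longrightarrow>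
                (\<exists>\<Sigma>'. rational_fan N k \<Sigma>' \<and> \<Sigma> = fan_pullback (map_prod id \<iota>) \<Sigma>'))))"
proof (intro conjI allI impI)
  obtain \<gamma> where \<gamma>: "\<gamma> \<in> \<Gamma>" "\<gamma> \<noteq> 0" using assms(2,3) by (auto simp: add_subgroup_def)
  fix \<Sigma> assume \<Sigma>: "admissible_fan N \<Gamma> \<Sigma>"
  obtain S where S: "S \<subseteq> \<Gamma>" "finite S" "admissible_fan N S \<Sigma>"
    using admissible_fan_finitely_many_slopes[OF \<Sigma>] by blast
  \<comment> \<open>Adding \<open>\<gamma>\<close> ensures a nonzero slope even if those of
    \<open>\<Sigma>\<close> are all 0, so that a positive \<open>k\<close> results.\<close>
  have "admissible_fan N (insert \<gamma> S) \<Sigma>" using admissible_fan_mono[OF S(3)] by blast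
  then show "\<exists>k>0. \<exists>\<Sigma>' \<iota>. rational_fan N k \<Sigma>' \<and> ray_map \<Gamma> k \<iota> \<and>
      \<Sigma> = fan_pullback (map_prod id \<iota>) \<Sigma>'"
    using ex_ray_map_for_span[OF assms(1,2), of "insert \<gamma> S" "insert \<gamma> S"] S(1,2) \<gamma>
      rat_real.span_superset[of "insert \<gamma> S"] by blast
next
  assume "fg_subgroup \<Gamma> \<or> fin_dim_divisible_hull \<Gamma>"
  \<comment> \<open>\<open>B\<close> consists of generators in the first case and is a finite
    spanning set of the divisible hull in the second.\<close>
  then obtain B where B: "finite B" "\<Gamma> \<subseteq> rat_real.span B"
    using add_subgroup_hull_subset_rat_span rat_real.span_superset[of \<Gamma>]
    unfolding fg_subgroup_def fin_dim_divisible_hull_def by metis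
  have "\<not> \<Gamma> \<subseteq> {0}" using assms(2,3) by (auto simp: add_subgroup_def)
  then show "\<exists>k>0. \<exists>\<iota>. ray_map \<Gamma> k \<iota> \<and>
      (\<forall>\<Sigma>. admissible_fan N \<Gamma> \<Sigma> \<longrightarrow>
        (\<exists>\<Sigma>'. rational_fan N k \<Sigma>' \<and> \<Sigma> = fan_pullback (map_prod id \<iota>) \<Sigma>'))"
    using ex_ray_map_for_span[OF assms(1,2) order_refl _ B] by blast
qed

end
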